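(* Let $\{T(t)\}_{t\ge 0}$ be a $C_0$-semigroup (of scalar type spectral operators) on a complex Banach space $X\neq\{0\}$ generated by a scalar type spectral operator $A$ with spectral measure $E_A(\cdot)$. Then $\{T(t)\}_{t\ge 0}$ is uniformly exponentially stable if and only if $$s(A)<0,$$ in which case $$\|T(t)\|\le 4M_0e^{\omega_0 t},\quad t\ge 0,$$ where $$\omega_0=s(A)\quad\text{and}\quad M_0:=\sup_{\delta\in\mathscr{B}(\mathbb{C})}\|E_A(\delta)\|\ge 1.$$
   Context: $\mathscr{B}(\mathbb{C})$ is the Borel $\sigma$-algebra on $\mathbb{C}$. The norm of operators is the operator norm. For a closed linear operator $A$ in $X$, the resolvent set $\rho(A)$ is the set of $\lambda\in\mathbb{C}$ for which $(A-\lambda I)^{-1}$ exists as a bounded linear operator on $X$, and $\sigma(A)=\mathbb{C}\setminus\rho(A)$. Scalar type spectral operator: a densely defined closed linear operator $A$ in $X$ for which there is a strongly $\sigma$-additive spectral measure (resolution of the identity) $E_A(\cdot)$, assigning to each Borel subset of $\mathbb{C}$ a bounded projection operator on $X$ (with $E_A(\emptyset)=0$, $E_A(\mathbb{C})=I$, $E_A(\delta\cap\delta')=E_A(\delta)E_A(\delta')$), having $\sigma(A)$ as its support, and such that $A=\int_{\sigma(A)}\lambda\,dE_A(\lambda)$, i.e., $Af=\lim_{n\to\infty}\int_{\{|\lambda|\le n\}}\lambda\,dE_A(\lambda)f$ with domain $D(A)$ consisting of exactly those $f\in X$ for which this limit exists. By strong $\sigma$-additivity, the spectral measure is uniformly bounded.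 When a scalar type spectral operator $A$ generates a $C_0$-semigroup, the semigroup is $T(t)=e^{tA}=\int_{\sigma(A)}e^{t\lambda}\,dE_A(\lambda)$, $t\ge 0$, and it consists of scalar type spectral operators. Spectral bound: $s(A):=\sup\{\operatorname{Re}\lambda : \lambda\in\sigma(A)\}$ ($-\infty$ if $\sigma(A)=\emptyset$). Growth bound: $\omega_0:=\inf\{\omega\in\mathbb{R} : \exists\, M=M(\omega)\ge 1 \text{ such that } \|T(t)\|\le Me^{\omega t} \text{ for all } t\ge 0\}$. Uniformly exponentially stable: $\omega_0<0$, or equivalently, there exist $\omega<0$ and $M=M(\omega)\ge 1$ with $\|T(t)\|\le Me^{\omega t}$ for all $t\ge 0$. *)

theory Defs
  imports "HOL-Analysis.Analysis"
begin

class complex_normed_vector = real_normed_vector +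
  fixes scaleC :: "complex \<Rightarrow> 'a \<Rightarrow> 'a"  (infixr \<open>*\<^sub>C\<close> 75)
  assumes scaleC_add_right: "c *\<^sub>C (x + y) = c *\<^sub>C x + c *\<^sub>C y"
    and scaleC_add_left: "(c + d) *\<^sub>C x = c *\<^sub>C x + d *\<^sub>C x"
    and scaleC_scaleC: "c *\<^sub>C d *\<^sub>C x = (c * d) *\<^sub>C x"
    and scaleR_scaleC: "r *\<^sub>R x = complex_of_real r *\<^sub>C x"
    and norm_scaleC: "norm (c *\<^sub>C x) = cmod c * norm x"

class complex_banach = complex_normed_vector + banach

text \<open>Bounded operators are elements of \<^typ>\<open>'a \<Rightarrow>\<^sub>L 'a\<close> that are in addition complex
  homogeneous; the norm of that type is the operator norm.\<close>

definition complex_homogeneous ::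
    "('a::complex_normed_vector \<Rightarrow>\<^sub>L 'b::complex_normed_vector) \<Rightarrow> bool" where
  "complex_homogeneous B \<longleftrightarrow> (\<forall>c x. blinfun_apply B (c *\<^sub>C x) = c *\<^sub>C blinfun_apply B x)"

lemma bounded_linear_scaleC: "bounded_linear (\<lambda>x::'a::complex_normed_vector. c *\<^sub>C x)"
proof (rule bounded_linear_intro[where K = "cmod c"])
  fix x y :: 'a and r :: real
  show "c *\<^sub>C (x + y) = c *\<^sub>C x + c *\<^sub>C y"
    by (rule scaleC_add_right)
  show "c *\<^sub>C r *\<^sub>R x = r *\<^sub>R c *\<^sub>C x"
    by (simp add: scaleR_scaleC scaleC_scaleC mult.commute)
  show "norm (c *\<^sub>C x) \<le> norm x * cmod c"
    by (simp add: norm_scaleC mult.commute)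
qed

instantiation blinfun :: (real_normed_vector, complex_normed_vector) complex_normed_vector
begin

lift_definition scaleC_blinfun :: "complex \<Rightarrow> 'a \<Rightarrow>\<^sub>L 'b \<Rightarrow> 'a \<Rightarrow>\<^sub>L 'b"
  is "\<lambda>c f x. c *\<^sub>C f x"
  by (rule bounded_linear_compose[OF bounded_linear_scaleC])

instance
proof
  fix c d :: complex and r :: real and f g :: "'a \<Rightarrow>\<^sub>L 'b"
  show "c *\<^sub>C (f + g) = c *\<^sub>C f + c *\<^sub>C g"
    by transfer (simp add: scaleC_add_right)
  show "(c + d) *\<^sub>C f = c *\<^sub>C f + d *\<^sub>C f"
    by transfer (simp add: scaleC_add_left)
  show "c *\<^sub>C d *\<^sub>C f = (c * d) *\<^sub>C f"
    by transfer (simp add: scaleC_scaleC)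
  show "r *\<^sub>R f = complex_of_real r *\<^sub>C f"
    by transfer (simp add: scaleR_scaleC)
  show "norm (c *\<^sub>C f) = cmod c * norm f"
  proof (transfer fixing: c)
    fix h :: "'a \<Rightarrow> 'b"
    assume "bounded_linear h"
    then have "onorm (\<lambda>x. cmod c *\<^sub>R h x) = \<bar>cmod c\<bar> * onorm h"
      by (rule onorm_scaleR)
    then show "onorm (\<lambda>x. c *\<^sub>C h x) = cmod c * onorm h"
      by (simp add: onorm_def norm_scaleC)
  qed
qed

end

text \<open>An operator in \<^typ>\<open>'a\<close> is given by its domain \<open>D\<close> and a function \<open>A\<close>,
  of which only the values on \<open>D\<close> matter.\<close>

definition closed_linear_operator :: "'a::complex_banach set \<Rightarrow> ('a \<Rightarrow> 'a) \<Rightarrow> bool" where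
  "closed_linear_operator D A \<longleftrightarrow>
     0 \<in> D \<and>
     (\<forall>x\<in>D. \<forall>y\<in>D. x + y \<in> D \<and> A (x + y) = A x + A y) \<and>
     (\<forall>c. \<forall>x\<in>D. c *\<^sub>C x \<in> D \<and> A (c *\<^sub>C x) = c *\<^sub>C A x) \<and>
     closed {(x, A x) | x. x \<in> D}"

definition resolvent_set :: "'a::complex_banach set \<Rightarrow> ('a \<Rightarrow> 'a) \<Rightarrow> complex set" where
  "resolvent_set D A = {z. \<exists>R :: 'a \<Rightarrow>\<^sub>L 'a. complex_homogeneous R \<and>
     (\<forall>x. blinfun_apply R x \<in> D \<and> A (blinfun_apply R x) - z *\<^sub>C blinfun_apply R x = x) \<and>
     (\<forall>x\<in>D. blinfun_apply R (A x - z *\<^sub>C x) = x)}"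

definition spectrum :: "'a::complex_banach set \<Rightarrow> ('a \<Rightarrow> 'a) \<Rightarrow> complex set" where
  "spectrum D A = - resolvent_set D A"

definition spectral_bound :: "'a::complex_banach set \<Rightarrow> ('a \<Rightarrow> 'a) \<Rightarrow> ereal" where
  "spectral_bound D A = (SUP z\<in>spectrum D A. ereal (Re z))"

text \<open>Only the values of \<open>E\<close> on Borel sets matter. That they are projections is the case
  \<open>\<delta> = \<delta>'\<close> of multiplicativity.\<close>

definition spectral_measure :: "(complex set \<Rightarrow> 'a::complex_banach \<Rightarrow>\<^sub>L 'a) \<Rightarrow> bool" where
  "spectral_measure E \<longleftrightarrow>
     (\<forall>\<delta>\<in>sets borel. complex_homogeneous (E \<delta>)) \<and>
     E {} = 0 \<and> E UNIV = id_blinfun \<and>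
     (\<forall>\<delta>\<in>sets borel. \<forall>\<delta>'\<in>sets borel. E (\<delta> \<inter> \<delta>') = E \<delta> o\<^sub>L E \<delta>') \<and>
     (\<forall>\<Delta> :: nat \<Rightarrow> complex set. range \<Delta> \<subseteq> sets borel \<longrightarrow> disjoint_family \<Delta> \<longrightarrow>
        (\<forall>x. (\<lambda>n. blinfun_apply (E (\<Delta> n)) x) sums blinfun_apply (E (\<Union>n. \<Delta> n)) x))"

definition spectral_support :: "(complex set \<Rightarrow> 'a::complex_banach \<Rightarrow>\<^sub>L 'a) \<Rightarrow> complex set" where
  "spectral_support E = {z. \<forall>U. open U \<longrightarrow> z \<in> U \<longrightarrow> E U \<noteq> 0}"

definition simple_spectral_integral ::
    "(complex set \<Rightarrow> 'a::complex_banach \<Rightarrow>\<^sub>L 'a) \<Rightarrow> (complex \<Rightarrow> complex) \<Rightarrow> 'a \<Rightarrow>\<^sub>L 'a" where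
  "simple_spectral_integral E s = (\<Sum>c\<in>range s. c *\<^sub>C E (s -` {c}))"

text \<open>The integral of a bounded Borel function is the limit, in operator norm, of the integrals
  of simple functions converging to it uniformly; it does not depend on their choice.\<close>

definition bounded_spectral_integral ::
    "(complex set \<Rightarrow> 'a::complex_banach \<Rightarrow>\<^sub>L 'a) \<Rightarrow> (complex \<Rightarrow> complex) \<Rightarrow> 'a \<Rightarrow>\<^sub>L 'a" where
  "bounded_spectral_integral E F = (THE B. \<exists>s :: nat \<Rightarrow> complex \<Rightarrow> complex.
     (\<forall>n. simple_function borel (s n)) \<and> uniform_limit UNIV s F sequentially \<and>
     (\<lambda>n. simple_spectral_integral E (s n)) \<longlonglongrightarrow> B)"

definition truncated_spectral_integral ::
    "(complex set \<Rightarrow> 'a::complex_banach \<Rightarrow>\<^sub>L 'a) \<Rightarrow> complex set \<Rightarrow> nat \<Rightarrow> 'a \<Rightarrow>\<^sub>L 'a" where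
  "truncated_spectral_integral E S n =
     bounded_spectral_integral E (\<lambda>z. if z \<in> S \<and> cmod z \<le> real n then z else 0)"

definition scalar_type_spectral_operator ::
    "'a::complex_banach set \<Rightarrow> ('a \<Rightarrow> 'a) \<Rightarrow> (complex set \<Rightarrow> 'a \<Rightarrow>\<^sub>L 'a) \<Rightarrow> bool" where
  "scalar_type_spectral_operator D A E \<longleftrightarrow>
     closed_linear_operator D A \<and> closure D = UNIV \<and>
     spectral_measure E \<and> spectral_support E = spectrum D A \<and>
     D = {x. convergent (\<lambda>n. blinfun_apply (truncated_spectral_integral E (spectrum D A) n) x)} \<and>
     (\<forall>x\<in>D. (\<lambda>n. blinfun_apply (truncated_spectral_integral E (spectrum D A) n) x) \<longlonglongrightarrow> A x)"

text \<open>Only the values of \<open>T\<close> at nonnegative times matter.\<close>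

definition C0_semigroup :: "(real \<Rightarrow> 'a::complex_banach \<Rightarrow>\<^sub>L 'a) \<Rightarrow> bool" where
  "C0_semigroup T \<longleftrightarrow>
     (\<forall>t\<ge>0. complex_homogeneous (T t)) \<and>
     T 0 = id_blinfun \<and>
     (\<forall>s\<ge>0. \<forall>t\<ge>0. T (s + t) = T s o\<^sub>L T t) \<and>
     (\<forall>x. ((\<lambda>t. blinfun_apply (T t) x) \<longlongrightarrow> x) (at_right 0))"

definition generates ::
    "'a::complex_banach set \<Rightarrow> ('a \<Rightarrow> 'a) \<Rightarrow> (real \<Rightarrow> 'a \<Rightarrow>\<^sub>L 'a) \<Rightarrow> bool" where
  "generates D A T \<longleftrightarrow>
     D = {x. \<exists>y. ((\<lambda>t. (1 / t) *\<^sub>R (blinfun_apply (T t) x - x)) \<longlongrightarrow> y) (at_right 0)} \<and>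
     (\<forall>x\<in>D. ((\<lambda>t. (1 / t) *\<^sub>R (blinfun_apply (T t) x - x)) \<longlongrightarrow> A x) (at_right 0))"

definition growth_bound :: "(real \<Rightarrow> 'a::complex_banach \<Rightarrow>\<^sub>L 'a) \<Rightarrow> ereal" where
  "growth_bound T =
     (INF \<omega>\<in>{\<omega> :: real. \<exists>M\<ge>1. \<forall>t\<ge>0. norm (T t) \<le> M * exp (\<omega> * t)}. ereal \<omega>)"

definition uniformly_exponentially_stable :: "(real \<Rightarrow> 'a::complex_banach \<Rightarrow>\<^sub>L 'a) \<Rightarrow> bool" where
  "uniformly_exponentially_stable T \<longleftrightarrow> growth_bound T < 0"

end

theory Submission
  imports Defs
begin

text \<open>
  Write \<open>S\<close> for the spectrum of \<open>A\<close> and \<open>M\<^sub>0\<close> for the supremum of the norms of the projections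
  \<open>E \<delta>\<close>. The semigroup acts as \<open>T t = \<integral> exp (t * z) dE z\<close>, the integral being taken over \<open>S\<close>, and
  an integral \<open>\<integral> f dE\<close> has norm at most \<open>4 * M\<^sub>0 * sup |f|\<close>. Since \<open>|exp (t * z)| = exp (t * Re z)\<close>,
  an upper bound \<open>\<sigma>\<close> of the real parts on \<open>S\<close> gives \<open>\<parallel>T t\<parallel> \<le> 4 * M\<^sub>0 * exp (\<sigma> * t)\<close>. Conversely,
  if \<open>z\<close> is in \<open>S\<close>, the support of \<open>E\<close>, then \<open>E\<close> does not vanish on small discs about \<open>z\<close>, and on a nonzero
  vector \<open>x\<close> in the range of such a projection the inverse \<open>\<integral> exp (- t * z) dE z\<close> is bounded in the
  same way, so that \<open>T t x\<close> decays no faster than \<open>exp (t * (Re z - \<epsilon>))\<close>. Hence the growth bound is the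
  spectral bound.

  It is enough to treat the spectral subspaces on which \<open>A\<close> is bounded. On the range of \<open>E \<delta>\<close>, for
  bounded \<open>\<delta> \<subseteq> S\<close>, the operator \<open>A\<close> is the norm limit of integrals \<open>\<integral> s\<^sub>n dE\<close> of simple functions
  (\<open>scalar_type_on_bounded_spectral_subspace\<close>). Differentiating
  \<open>r \<mapsto> T (t - r) (\<integral> exp (r * s\<^sub>n) dE) x\<close>, a finite sum of differentiable terms, bounds the distance of
  \<open>T t x\<close> from \<open>(\<integral> exp (t * s\<^sub>n) dE) x\<close> by a multiple of the distance of \<open>\<integral> s\<^sub>n dE\<close> from \<open>A\<close>
  (\<open>norm_semigroup_minus_exp_simple_le\<close>). So \<open>T t x\<close> is a limit of integrals of simple functions,
  and both estimates pass to it. The ranges of the \<open>E \<delta>\<close> are dense because \<open>E S\<close> is the identity.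

  The factor 4 comes from splitting a complex function into the positive and negative parts of its
  real and imaginary parts: the integral of a simple function with values in \<open>{0..C}\<close> is \<open>C\<close> times
  a convex combination of projections \<open>E \<delta>\<close> (\<open>norm_complex_combination_le\<close>).
  Finiteness of \<open>M\<^sub>0\<close> and local boundedness of \<open>T\<close> come from the uniform boundedness principle.
\<close>

section \<open>Uniform boundedness\<close>

text \<open>
  The space is the union of the closed sets on which the whole family is bounded by \<open>n\<close>, so by
  Baire's theorem one of these sets contains a ball. Linearity carries the bound on the ball over to
  a bound on the operator norms.
\<close>

lemma uniform_boundedness:
  fixes F :: "('a::banach \<Rightarrow>\<^sub>L 'b::real_normed_vector) set"
  assumes "\<And>x. \<exists>K. \<forall>f\<in>F. norm (blinfun_apply f x) \<le> K"
  obtains K where "0 \<le> K" "\<And>f. f \<in> F \<Longrightarrow> norm f \<le> K"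
proof -
  define C where "C n = {x. \<forall>f\<in>F. norm (blinfun_apply f x) \<le> real n}" for n
  have closed: "closed (C n)" for n
  proof -
    have "C n = (\<Inter>f\<in>F. {x. norm (blinfun_apply f x) \<le> real n})"
      by (auto simp: C_def)
    then show ?thesis
      by (simp only:) (intro closed_INT ballI closed_Collect_le continuous_intros)
  qed
  have "(\<Union>n. C n) = UNIV"
  proof -
    have "\<exists>n. x \<in> C n" for x
    proof -
      obtain K where "\<forall>f\<in>F. norm (blinfun_apply f x) \<le> K"
        using assms by blast
      moreover obtain n where "K \<le> real n"
        using real_arch_simple by blast
      ultimately show ?thesis
        by (auto simp: C_def intro: order_trans)
    qed
    then show ?thesis by blast
  qed
  moreover have "euclidean interior_of \<Union> (range C) = {}" if "\<forall>n. interior (C n) = {}"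
    by (rule Baire_category_alt) (use that closed completely_metrizable_space_euclidean in \<open>auto\<close>)
  ultimately obtain n where "interior (C n) \<noteq> {}"
    by (auto simp: interior_of_topspace[of euclidean, simplified])
  then obtain x0 r where r: "0 < r" "ball x0 r \<subseteq> C n"
    by (metis all_not_in_conv mem_interior)
  have bound: "norm (blinfun_apply f x) \<le> 4 * real n / r * norm x" if "f \<in> F" for f x
  proof (cases "x = 0")
    case False
    define y where "y = (r / (2 * norm x)) *\<^sub>R x"
    have "x0 + y \<in> C n" "x0 \<in> C n"
      using r False by (auto simp: y_def dist_norm intro!: subsetD[OF r(2)])
    then have "norm (blinfun_apply f (x0 + y)) \<le> n" "norm (blinfun_apply f x0) \<le> n"
      using that by (auto simp: C_def)
    then have "norm (blinfun_apply f (x0 + y) - blinfun_apply f x0) \<le> 2 * n"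
      using norm_triangle_ineq4[of "blinfun_apply f (x0 + y)" "blinfun_apply f x0"] by linarith
    then have "(r / (2 * norm x)) * norm (blinfun_apply f x) \<le> 2 * n"
      using r False by (simp add: y_def blinfun.bilinear_simps)
    then show ?thesis
      using r False by (simp add: field_simps)
  qed (simp add: blinfun.bilinear_simps)
  show ?thesis
  proof (rule that)
    show "0 \<le> 4 * real n / r" using r by simp
    then show "norm f \<le> 4 * real n / r" if "f \<in> F" for f
      using bound[OF that] by (auto intro: norm_blinfun_bound)
  qed
qed

section \<open>Complex linear combinations\<close>

lemma bounded_bilinear_scaleC:
  "bounded_bilinear (\<lambda>(c::complex) (x::'a::complex_normed_vector). c *\<^sub>C x)"
proof
  fix c d :: complex and x y :: 'a and r :: real
  show "(c + d) *\<^sub>C x = c *\<^sub>C x + d *\<^sub>C x" by (rule scaleC_add_left)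
  show "c *\<^sub>C (x + y) = c *\<^sub>C x + c *\<^sub>C y" by (rule scaleC_add_right)
  show "(r *\<^sub>R c) *\<^sub>C x = r *\<^sub>R c *\<^sub>C x"
    by (simp add: scaleR_scaleC scaleC_scaleC scaleR_conv_of_real)
  show "c *\<^sub>C r *\<^sub>R x = r *\<^sub>R c *\<^sub>C x"
    by (simp add: scaleR_scaleC scaleC_scaleC mult.commute)
  show "\<exists>K. \<forall>c (x::'a). norm (c *\<^sub>C x) \<le> norm c * norm x * K"
    by (auto intro!: exI[of _ 1] simp: norm_scaleC)
qed

interpretation scaleC: bounded_bilinear "\<lambda>(c::complex) (x::'a::complex_normed_vector). c *\<^sub>C x"
  by (rule bounded_bilinear_scaleC)

lemma scaleC_one: "1 *\<^sub>C (x::'a::complex_normed_vector) = x"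
  using scaleR_scaleC[of 1 x] by simp

text \<open>
  The norm is convex, so on the cube of coefficient vectors it is largest at a vertex, where the sum
  is one over a subset of \<open>I\<close>. The summand \<open>v\<close> is there for the induction, which absorbs one term
  into it.
\<close>

lemma norm_unit_combination_le:
  fixes x :: "'i \<Rightarrow> 'a::real_normed_vector"
  assumes "finite I" "\<And>J. J \<subseteq> I \<Longrightarrow> norm (v + sum x J) \<le> K"
    and "\<And>i. i \<in> I \<Longrightarrow> 0 \<le> a i \<and> a i \<le> 1"
  shows "norm (v + (\<Sum>i\<in>I. a i *\<^sub>R x i)) \<le> K"
  using assms
proof (induction I arbitrary: v rule: finite_induct)
  case empty
  then show ?case by simp
next
  case (insert j I)
  define S where "S = (\<Sum>i\<in>I. a i *\<^sub>R x i)"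
  have "norm (v + S) \<le> K"
    unfolding S_def using insert.prems by (intro insert.IH) auto
  moreover have "norm ((v + x j) + S) \<le> K"
    unfolding S_def
  proof (rule insert.IH)
    fix J assume "J \<subseteq> I"
    then have "norm (v + sum x (insert j J)) \<le> K"
      by (intro insert.prems) auto
    moreover have "finite J" "j \<notin> J"
      using \<open>J \<subseteq> I\<close> insert.hyps by (auto intro: finite_subset)
    ultimately show "norm (v + x j + sum x J) \<le> K"
      by (simp add: add.assoc)
  qed (use insert.prems in auto)
  ultimately have "norm ((1 - a j) *\<^sub>R (v + S) + a j *\<^sub>R ((v + x j) + S)) \<le> (1 - a j) * K + a j * K"
    using insert.prems(2)[of j]
    by (intro norm_triangle_le add_mono) (auto intro!: mult_left_mono)
  moreover have "(1 - a j) *\<^sub>R (v + S) + a j *\<^sub>R ((v + x j) + S) = v + (\<Sum>i\<in>insert j I. a i *\<^sub>R x i)"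
    using insert.hyps by (simp add: S_def algebra_simps)
  moreover have "(1 - a j) * K + a j * K = K"
    by (simp add: algebra_simps)
  ultimately show ?case by (simp only:)
qed

lemma norm_nonneg_combination_le:
  fixes x :: "'i \<Rightarrow> 'a::real_normed_vector"
  assumes "finite I" "\<And>J. J \<subseteq> I \<Longrightarrow> norm (sum x J) \<le> K"
    and a: "\<And>i. i \<in> I \<Longrightarrow> 0 \<le> a i \<and> a i \<le> C" and "0 \<le> C"
  shows "norm (\<Sum>i\<in>I. a i *\<^sub>R x i) \<le> K * C"
proof (cases "C > 0")
  case True
  have "norm (0 + (\<Sum>i\<in>I. (a i / C) *\<^sub>R x i)) \<le> K"
    using assms True by (intro norm_unit_combination_le) auto
  then have "C * norm (\<Sum>i\<in>I. (a i / C) *\<^sub>R x i) \<le> C * K"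
    using True by simp
  moreover have "(\<Sum>i\<in>I. a i *\<^sub>R x i) = C *\<^sub>R (\<Sum>i\<in>I. (a i / C) *\<^sub>R x i)"
    using True by (simp add: scaleR_sum_right)
  ultimately show ?thesis using True by (simp add: mult.commute)
next
  case False
  then have "C = 0" using \<open>0 \<le> C\<close> by simp
  then have "a i = 0" if "i \<in> I" for i
    using a[OF that] by simp
  then show ?thesis using \<open>C = 0\<close> by simp
qed

text \<open>
  Applied to the projections of a partition, whose partial sums are again projections \<open>E \<delta>\<close>, this
  bounds the integral of a simple function. The four terms are the positive and negative parts of
  the real and imaginary parts.
\<close>

lemma norm_complex_combination_le:
  fixes x :: "'i \<Rightarrow> 'a::complex_normed_vector"
  assumes I: "finite I" "\<And>J. J \<subseteq> I \<Longrightarrow> norm (sum x J) \<le> K"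
    and c: "\<And>i. i \<in> I \<Longrightarrow> cmod (c i) \<le> C" and C: "0 \<le> C"
  shows "norm (\<Sum>i\<in>I. c i *\<^sub>C x i) \<le> 4 * K * C"
proof -
  define P where "P f = (\<Sum>i\<in>I. max (f (c i)) 0 *\<^sub>R x i)" for f :: "complex \<Rightarrow> real"
  have P: "norm (P f) \<le> K * C" if "\<And>z. \<bar>f z\<bar> \<le> cmod z" for f
    unfolding P_def
  proof (rule norm_nonneg_combination_le[OF I _ C])
    fix i assume "i \<in> I"
    show "0 \<le> max (f (c i)) 0 \<and> max (f (c i)) 0 \<le> C"
      using c[OF \<open>i \<in> I\<close>] that[of "c i"] by auto
  qed
  have decomp: "c i *\<^sub>C x i = max (Re (c i)) 0 *\<^sub>R x i - max (- Re (c i)) 0 *\<^sub>R x i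
      + \<i> *\<^sub>C (max (Im (c i)) 0 *\<^sub>R x i - max (- Im (c i)) 0 *\<^sub>R x i)" for i
  proof -
    have "max (Re (c i)) 0 *\<^sub>R x i - max (- Re (c i)) 0 *\<^sub>R x i = Re (c i) *\<^sub>R x i"
      "max (Im (c i)) 0 *\<^sub>R x i - max (- Im (c i)) 0 *\<^sub>R x i = Im (c i) *\<^sub>R x i"
      by (simp_all add: max_def flip: scaleR_diff_left)
    then show ?thesis
      by (simp add: scaleR_scaleC scaleC_scaleC flip: scaleC_add_left complex_eq)
  qed
  have "(\<Sum>i\<in>I. c i *\<^sub>C x i) = P Re - P (\<lambda>z. - Re z) + \<i> *\<^sub>C (P Im - P (\<lambda>z. - Im z))"
    unfolding P_def decomp by (simp add: sum.distrib sum_subtractf scaleC.sum_right scaleC.diff_right)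
  also have "norm \<dots> \<le> (norm (P Re) + norm (P (\<lambda>z. - Re z))) + (norm (P Im) + norm (P (\<lambda>z. - Im z)))"
    by (intro norm_triangle_le add_mono norm_triangle_ineq4) (simp add: norm_scaleC norm_triangle_ineq4)
  also have "\<dots> \<le> (K * C + K * C) + (K * C + K * C)"
    by (intro add_mono P) (auto simp: abs_Re_le_cmod abs_Im_le_cmod)
  finally show ?thesis by (simp add: algebra_simps)
qed

section \<open>Spectral measures\<close>

text \<open>
  The constant \<open>M\<^sub>0\<close>. The supremum is a genuine one by \<open>bdd_above_E\<close> below.
\<close>

definition measure_bound :: "(complex set \<Rightarrow> 'a::complex_banach \<Rightarrow>\<^sub>L 'a) \<Rightarrow> real" where
  "measure_bound E = (SUP \<delta>\<in>sets borel. norm (E \<delta>))"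

context
  fixes E :: "complex set \<Rightarrow> 'a::complex_banach \<Rightarrow>\<^sub>L 'a"
  assumes E: "spectral_measure E"
begin

lemma E_empty: "E {} = 0" and E_UNIV: "E UNIV = id_blinfun"
  using E by (auto simp: spectral_measure_def)

lemma E_Int:
  assumes "\<delta> \<in> sets borel" "\<delta>' \<in> sets borel"
  shows "E (\<delta> \<inter> \<delta>') = E \<delta> o\<^sub>L E \<delta>'"
  using E assms by (auto simp: spectral_measure_def)

lemma E_Int_apply:
  assumes "\<delta> \<in> sets borel" "\<delta>' \<in> sets borel"
  shows "blinfun_apply (E \<delta>) (blinfun_apply (E \<delta>') x) = blinfun_apply (E (\<delta> \<inter> \<delta>')) x"
  by (simp add: E_Int assms)

lemma E_scaleC:
  "\<delta> \<in> sets borel \<Longrightarrow> blinfun_apply (E \<delta>) (c *\<^sub>C x) = c *\<^sub>C blinfun_apply (E \<delta>) x"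
  using E by (auto simp: spectral_measure_def complex_homogeneous_def)

lemma E_sums:
  assumes "range \<Delta> \<subseteq> sets borel" "disjoint_family \<Delta>"
  shows "(\<lambda>n::nat. blinfun_apply (E (\<Delta> n)) x) sums blinfun_apply (E (\<Union>n. \<Delta> n)) x"
  using E assms by (auto simp: spectral_measure_def)

lemma E_Un_disjoint:
  assumes "\<delta> \<in> sets borel" "\<delta>' \<in> sets borel" "\<delta> \<inter> \<delta>' = {}"
  shows "E (\<delta> \<union> \<delta>') = E \<delta> + E \<delta>'"
proof (rule blinfun_eqI)
  fix x
  have "(\<lambda>n. blinfun_apply (E (binaryset \<delta> \<delta>' n)) x) sums blinfun_apply (E (\<Union>n. binaryset \<delta> \<delta>' n)) x"
    using assms by (intro E_sums) (auto simp: range_binaryset_eq binaryset_def disjoint_family_on_def)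
  moreover have "(\<lambda>n. blinfun_apply (E (binaryset \<delta> \<delta>' n)) x) sums
      (blinfun_apply (E \<delta>) x + blinfun_apply (E \<delta>') x)"
    by (rule binaryset_sums) (simp add: E_empty)
  ultimately show "blinfun_apply (E (\<delta> \<union> \<delta>')) x = blinfun_apply (E \<delta> + E \<delta>') x"
    by (simp add: UN_binaryset_eq sums_unique2 blinfun.add_left)
qed

lemma E_split:
  assumes "\<delta> \<in> sets borel" "\<delta>' \<in> sets borel"
  shows "E \<delta> = E (\<delta> \<inter> \<delta>') + E (\<delta> - \<delta>')"
proof -
  have "\<delta> \<inter> \<delta>' \<inter> (\<delta> - \<delta>') = {}" by blast
  from E_Un_disjoint[OF _ _ this] assms show ?thesis
    by (simp add: Int_Diff_Un)
qed

lemma E_UN_disjoint: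
  assumes "finite I" "\<And>i. i \<in> I \<Longrightarrow> \<Delta> i \<in> sets borel" "disjoint_family_on \<Delta> I"
  shows "E (\<Union>i\<in>I. \<Delta> i) = (\<Sum>i\<in>I. E (\<Delta> i))"
  using assms
proof (induction I rule: finite_induct)
  case empty
  then show ?case by (simp add: E_empty)
next
  case (insert i I)
  have "\<Delta> i \<inter> (\<Union>j\<in>I. \<Delta> j) = {}"
    using insert.hyps insert.prems(2) by (auto simp: disjoint_family_on_def)
  then have "E (\<Delta> i \<union> (\<Union>j\<in>I. \<Delta> j)) = E (\<Delta> i) + E (\<Union>j\<in>I. \<Delta> j)"
    using insert by (intro E_Un_disjoint sets.finite_UN) auto
  moreover have "disjoint_family_on \<Delta> I"
    using insert.prems(2) by (auto simp: disjoint_family_on_def)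
  ultimately show ?case
    using insert by simp
qed

text \<open>
  If the values \<open>E \<delta>' x\<close> on Borel subsets of \<open>\<delta>\<close> are unbounded, split \<open>\<delta>\<close> into two pieces on each of
  which \<open>E\<close> has a value of norm at least 1 at \<open>x\<close>. On one of the pieces the values are again
  unbounded; continue with it and put the other one aside. The pieces put aside are disjoint, and the
  series of their values has terms that do not tend to 0, against countable additivity.
\<close>

lemma E_pointwise_bounded: "\<exists>K. \<forall>\<delta>\<in>sets borel. norm (blinfun_apply (E \<delta>) x) \<le> K"
proof (rule ccontr)
  define bad where "bad \<delta> \<longleftrightarrow> \<delta> \<in> sets borel \<and>
    (\<forall>K. \<exists>\<delta>'\<in>sets borel. \<delta>' \<subseteq> \<delta> \<and> K < norm (blinfun_apply (E \<delta>') x))" for \<delta>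
  assume "\<not> ?thesis"
  then have bad_UNIV: "bad UNIV"
    by (auto simp: bad_def not_le)
  have not_bad: "\<exists>K. \<forall>\<delta>'\<in>sets borel. \<delta>' \<subseteq> \<delta> \<longrightarrow> norm (blinfun_apply (E \<delta>') x) \<le> K"
    if "\<not> bad \<delta>" "\<delta> \<in> sets borel" for \<delta>
    using that by (simp add: bad_def not_less)
  have bad_split: "bad (\<delta> \<inter> \<epsilon>) \<or> bad (\<delta> - \<epsilon>)" if "bad \<delta>" "\<epsilon> \<in> sets borel" for \<delta> \<epsilon>
  proof (rule ccontr)
    assume "\<not> ?thesis"
    then have nb: "\<not> bad (\<delta> \<inter> \<epsilon>)" "\<not> bad (\<delta> - \<epsilon>)" by simp_all
    have sets: "\<delta> \<inter> \<epsilon> \<in> sets borel" "\<delta> - \<epsilon> \<in> sets borel"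
      using that by (auto simp: bad_def)
    from not_bad[OF nb(1) sets(1)] obtain K where
      K: "\<And>\<delta>'. \<delta>' \<in> sets borel \<Longrightarrow> \<delta>' \<subseteq> \<delta> \<inter> \<epsilon> \<Longrightarrow> norm (blinfun_apply (E \<delta>') x) \<le> K"
      by metis
    from not_bad[OF nb(2) sets(2)] obtain L where
      L: "\<And>\<delta>'. \<delta>' \<in> sets borel \<Longrightarrow> \<delta>' \<subseteq> \<delta> - \<epsilon> \<Longrightarrow> norm (blinfun_apply (E \<delta>') x) \<le> L"
      by metis
    obtain \<delta>' where \<delta>': "\<delta>' \<in> sets borel" "\<delta>' \<subseteq> \<delta>" "K + L < norm (blinfun_apply (E \<delta>') x)"
      using \<open>bad \<delta>\<close> unfolding bad_def by blast
    have "norm (blinfun_apply (E \<delta>') x)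
        \<le> norm (blinfun_apply (E (\<delta>' \<inter> \<epsilon>)) x) + norm (blinfun_apply (E (\<delta>' - \<epsilon>)) x)"
      using E_split[OF \<delta>'(1) that(2)] by (simp add: blinfun.add_left norm_triangle_ineq)
    also have "\<dots> \<le> K + L"
      using \<delta>' that(2) by (intro add_mono K L) auto
    finally show False using \<delta>'(3) by simp
  qed
  have step: "\<exists>\<delta>'. bad \<delta>' \<and> \<delta>' \<subseteq> \<delta> \<and> 1 \<le> norm (blinfun_apply (E (\<delta> - \<delta>')) x)" if "bad \<delta>" for \<delta>
  proof -
    obtain \<epsilon> where \<epsilon>: "\<epsilon> \<in> sets borel" "\<epsilon> \<subseteq> \<delta>"
      "1 + norm (blinfun_apply (E \<delta>) x) < norm (blinfun_apply (E \<epsilon>) x)"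
      using \<open>bad \<delta>\<close> unfolding bad_def by blast
    have \<delta>: "\<delta> \<in> sets borel" and \<epsilon>': "\<delta> \<inter> \<epsilon> = \<epsilon>"
      using that \<epsilon> by (auto simp: bad_def)
    have "blinfun_apply (E \<delta>) x = blinfun_apply (E \<epsilon>) x + blinfun_apply (E (\<delta> - \<epsilon>)) x"
      using E_split[OF \<delta> \<epsilon>(1)] by (simp add: blinfun.add_left \<epsilon>')
    then have "norm (blinfun_apply (E \<epsilon>) x)
        \<le> norm (blinfun_apply (E \<delta>) x) + norm (blinfun_apply (E (\<delta> - \<epsilon>)) x)"
      by (metis add_diff_cancel_right' norm_triangle_ineq4)
    with \<epsilon>(3) have "1 \<le> norm (blinfun_apply (E (\<delta> - \<epsilon>)) x)" by simp
    moreover have "1 \<le> norm (blinfun_apply (E \<epsilon>) x)"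
      using \<epsilon>(3) norm_ge_zero[of "blinfun_apply (E \<delta>) x"] by linarith
    moreover have "bad \<epsilon> \<or> bad (\<delta> - \<epsilon>)"
      using bad_split[OF that \<epsilon>(1)] \<epsilon>' by simp
    moreover have "\<delta> - (\<delta> - \<epsilon>) = \<epsilon>" using \<epsilon>(2) by blast
    ultimately show ?thesis
      using \<epsilon>(2) Diff_subset[of \<delta> \<epsilon>]
      by (elim disjE) (rule exI[of _ \<epsilon>], simp, rule exI[of _ "\<delta> - \<epsilon>"], simp)
  qed
  have "\<exists>D. \<forall>n. bad (D n) \<and> D (Suc n) \<subseteq> D n \<and> 1 \<le> norm (blinfun_apply (E (D n - D (Suc n))) x)"
    by (rule dependent_nat_choice) (use bad_UNIV step in blast)+
  then obtain D where D: "\<And>n. bad (D n)" "\<And>n. D (Suc n) \<subseteq> D n"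
      "\<And>n. 1 \<le> norm (blinfun_apply (E (D n - D (Suc n))) x)"
    by blast
  have "antimono D"
    using D(2) by (rule decseq_SucI)
  have "disjoint_family (\<lambda>n. D n - D (Suc n))"
  proof -
    have "(D m - D (Suc m)) \<inter> (D n - D (Suc n)) = {}" if "m < n" for m n
      using antimonoD[OF \<open>antimono D\<close>, of "Suc m" n] that by auto
    then show ?thesis
      unfolding disjoint_family_on_def by (metis Int_commute nat_neq_iff)
  qed
  then have "summable (\<lambda>n. blinfun_apply (E (D n - D (Suc n))) x)"
    using D(1) by (intro sums_summable[OF E_sums]) (auto simp: bad_def)
  then have "(\<lambda>n. blinfun_apply (E (D n - D (Suc n))) x) \<longlonglongrightarrow> 0"
    by (rule summable_LIMSEQ_zero)
  then obtain n where "norm (blinfun_apply (E (D n - D (Suc n))) x) < 1"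
    by (auto dest!: LIMSEQ_D[where r = 1])
  with D(3)[of n] show False by simp
qed

lemma bdd_above_E: "bdd_above ((\<lambda>\<delta>. norm (E \<delta>)) ` sets borel)"
proof -
  have "\<exists>K. \<forall>f\<in>E ` sets borel. norm (blinfun_apply f x) \<le> K" for x
    using E_pointwise_bounded[of x] by auto
  then obtain K where "\<And>f. f \<in> E ` sets borel \<Longrightarrow> norm f \<le> K"
    using uniform_boundedness[of "E ` sets borel"] by blast
  then show ?thesis by (intro bdd_aboveI2[where M = K]) simp
qed

lemma norm_E_le: "\<delta> \<in> sets borel \<Longrightarrow> norm (E \<delta>) \<le> measure_bound E"
  unfolding measure_bound_def by (rule cSUP_upper[OF _ bdd_above_E])

lemma measure_bound_nonneg: "0 \<le> measure_bound E"
  using norm_E_le[of "{}"] order_trans[OF norm_ge_zero] by blast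

lemma measure_bound_ge_1:
  assumes "(UNIV :: 'a set) \<noteq> {0}"
  shows "1 \<le> measure_bound E"
proof -
  obtain x :: 'a where "x \<noteq> 0" using assms by blast
  then have "1 \<le> norm (id_blinfun :: 'a \<Rightarrow>\<^sub>L 'a)"
    using norm_blinfun[of id_blinfun x] by simp
  also have "\<dots> \<le> measure_bound E"
    using norm_E_le[of UNIV] by (simp add: E_UNIV)
  finally show ?thesis .
qed

text \<open>
  Continuity from below: the partial sums over the disjointed sequence are the values on \<open>\<Delta> n\<close>.
\<close>

lemma E_increasing_LIMSEQ:
  assumes "\<And>n. \<Delta> n \<in> sets borel" "incseq \<Delta>"
  shows "(\<lambda>n. blinfun_apply (E (\<Delta> n)) x) \<longlonglongrightarrow> blinfun_apply (E (\<Union>n. \<Delta> n)) x"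
proof -
  have borel: "disjointed \<Delta> n \<in> sets borel" for n
    using sets.range_disjointed_sets[of \<Delta> borel] assms(1) by auto
  have "(\<lambda>n. blinfun_apply (E (disjointed \<Delta> n)) x) sums blinfun_apply (E (\<Union>n. disjointed \<Delta> n)) x"
    using borel by (intro E_sums disjoint_family_disjointed) auto
  then have "(\<lambda>n. \<Sum>i\<le>n. blinfun_apply (E (disjointed \<Delta> i)) x) \<longlonglongrightarrow> blinfun_apply (E (\<Union>n. \<Delta> n)) x"
    by (simp add: sums_def_le UN_disjointed_eq)
  moreover have "(\<Sum>i\<le>n. blinfun_apply (E (disjointed \<Delta> i)) x) = blinfun_apply (E (\<Delta> n)) x" for n
  proof -
    have "(\<Union>i\<in>{..n}. disjointed \<Delta> i) = \<Delta> n"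
      using finite_UN_disjointed_eq[of \<Delta> "Suc n"] assms(2)
      by (auto simp: atLeast0LessThan lessThan_Suc_atMost incseq_def)
    moreover have "E (\<Union>i\<in>{..n}. disjointed \<Delta> i) = (\<Sum>i\<le>n. E (disjointed \<Delta> i))"
      using borel disjoint_family_disjointed[of \<Delta>]
      by (intro E_UN_disjoint) (auto simp: disjoint_family_on_def)
    ultimately show ?thesis by (simp add: blinfun.sum_left)
  qed
  ultimately show ?thesis by simp
qed

lemma E_null_subset:
  assumes "\<delta> \<in> sets borel" "\<delta>' \<in> sets borel" "\<delta> \<subseteq> \<delta>'" "E \<delta>' = 0"
  shows "E \<delta> = 0"
  using E_Int[of \<delta> \<delta>'] assms by (simp add: Int_absorb2)

lemma closed_spectral_support: "closed (spectral_support E)"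
proof -
  have "- spectral_support E = \<Union>{U. open U \<and> E U = 0}"
    by (auto simp: spectral_support_def)
  then have "open (- spectral_support E)" by auto
  then show ?thesis by (simp add: open_closed)
qed

text \<open>
  The complement of the support is a union of open null sets. By the Lindelof property countably many
  of them suffice, so the complement is itself a null set.
\<close>

lemma E_spectral_support: "E (spectral_support E) = id_blinfun"
proof -
  let ?S = "spectral_support E"
  have S: "?S \<in> sets borel" by (rule borel_closed[OF closed_spectral_support])
  obtain \<F> where \<F>: "\<F> \<subseteq> {U. open U \<and> E U = 0}" "countable \<F>" "\<Union>\<F> = \<Union>{U. open U \<and> E U = 0}"
    using Lindelof[of "{U. open U \<and> E U = 0}"] by auto
  \<comment> \<open>The empty set makes the countable family nonempty, so that it can be enumerated.\<close>
  have UN: "- ?S = \<Union>(insert {} \<F>)"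
    using \<F>(3) by (auto simp: spectral_support_def)
  define U where "U = from_nat_into (insert {} \<F>)"
  have range_U: "range U = insert {} \<F>"
    unfolding U_def using \<F>(2) by (intro range_from_nat_into) auto
  moreover have "insert {} \<F> \<subseteq> {U. open U \<and> E U = 0}"
    using \<F>(1) E_empty by simp
  ultimately have "range U \<subseteq> {U. open U \<and> E U = 0}"
    by (simp only:)
  then have "U n \<in> {U. open U \<and> E U = 0}" for n
    by (rule range_subsetD)
  then have U: "open (U n)" "E (U n) = 0" for n
    by simp_all
  have borel: "disjointed U n \<in> sets borel" for n
    using sets.range_disjointed_sets[of U borel] borel_open[OF U(1)] by (simp add: image_subset_iff)
  have "E (disjointed U n) = 0" for n
    by (rule E_null_subset[OF borel borel_open[OF U(1)] disjointed_subset U(2)])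
  then have "(\<lambda>n. 0) sums blinfun_apply (E (- ?S)) x" for x
    using E_sums[of "disjointed U" x] borel
    by (simp add: UN_disjointed_eq disjoint_family_disjointed UN range_U image_subset_iff)
  then have "blinfun_apply (E (- ?S)) x = 0" for x
    using sums_unique2 sums_zero by blast
  then have "E (- ?S) = 0" by (intro blinfun_eqI) simp
  moreover have "E UNIV = E ?S + E (- ?S)"
    using E_split[of UNIV ?S] S by (simp add: Compl_eq_Diff_UNIV)
  ultimately show ?thesis by (simp add: E_UNIV)
qed

end

section \<open>Integration with respect to a spectral measure\<close>

lemma simple_function_borel_vimage:
  "simple_function borel q \<Longrightarrow> q -` X \<in> sets borel"
  using simple_functionD(2)[of borel q X] by simp

lemma simple_function_borel_finite_range:
  "simple_function borel q \<Longrightarrow> finite (range q)"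
  using simple_functionD(1)[of borel q] by simp

lemma simple_function_borel_restrict:
  fixes f :: "'a::topological_space \<Rightarrow> 'b::zero"
  assumes "simple_function borel f" "\<delta> \<in> sets borel"
  shows "simple_function borel (\<lambda>z. if z \<in> \<delta> then f z else 0)"
  by (rule simple_function_If_set) (use assms in auto)

text \<open>
  Round the real and imaginary parts down to multiples of \<open>1 / Suc n\<close>; boundedness of \<open>F\<close> leaves
  finitely many values.
\<close>

lemma simple_approximation_exists:
  fixes F :: "complex \<Rightarrow> complex"
  assumes F: "F \<in> borel_measurable borel" and C: "\<And>z. cmod (F z) \<le> C"
  shows "\<exists>s. (\<forall>n. simple_function borel (s n)) \<and> uniform_limit UNIV s F sequentially"
proof -
  define a where "a n = real (Suc n)" for n
  have a: "a n > 0" for n by (simp add: a_def)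
  define r where "r n x = real_of_int \<lfloor>a n * x\<rfloor> / a n" for n x
  define s where "s n z = Complex (r n (Re (F z))) (r n (Im (F z)))" for n z
  have r: "\<bar>r n x - x\<bar> \<le> 1 / a n" for n x
  proof -
    have "r n x - x = (real_of_int \<lfloor>a n * x\<rfloor> - a n * x) / a n"
      using a[of n] by (simp add: r_def field_simps)
    moreover have "\<bar>real_of_int \<lfloor>a n * x\<rfloor> - a n * x\<bar> \<le> 1" by linarith
    ultimately show ?thesis using a[of n] by (simp add: divide_right_mono)
  qed
  have "simple_function borel (s n)" for n
  proof (rule simple_function_borel_measurable)
    show "s n \<in> borel_measurable borel"
      unfolding s_def[abs_def] r_def Complex_eq using F by measurable
    define N where "N = \<lceil>a n * C\<rceil> + 1"
    have floor: "\<lfloor>a n * x\<rfloor> \<in> {-N..N}" if "\<bar>x\<bar> \<le> C" for x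
    proof -
      have "\<bar>a n * x\<bar> \<le> a n * C"
        using that a[of n] by (simp add: abs_mult)
      then show ?thesis unfolding N_def by (simp add: abs_le_iff) linarith
    qed
    have "s n ` space borel \<subseteq> (\<lambda>(i, j). Complex (of_int i / a n) (of_int j / a n)) ` ({-N..N} \<times> {-N..N})"
    proof safe
      fix z
      have "\<bar>Re (F z)\<bar> \<le> C" "\<bar>Im (F z)\<bar> \<le> C"
        using C[of z] abs_Re_le_cmod[of "F z"] abs_Im_le_cmod[of "F z"] by linarith+
      then show "s n z \<in> (\<lambda>(i, j). Complex (of_int i / a n) (of_int j / a n)) ` ({-N..N} \<times> {-N..N})"
        unfolding s_def r_def by (intro image_eqI[of _ _ "(\<lfloor>a n * Re (F z)\<rfloor>, \<lfloor>a n * Im (F z)\<rfloor>)"])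
          (use floor in auto)
    qed
    then show "finite (s n ` space borel)"
      by (rule finite_subset) simp
  qed
  moreover have "uniform_limit UNIV s F sequentially"
  proof (rule uniform_limitI)
    fix e :: real assume "0 < e"
    have "(\<lambda>n. 2 / a n) \<longlonglongrightarrow> 2 * 0"
      unfolding a_def divide_inverse by (intro tendsto_mult tendsto_const LIMSEQ_inverse_real_of_nat)
    then have "\<forall>\<^sub>F n in sequentially. 2 / a n < e"
      using \<open>0 < e\<close> by (simp add: order_tendstoD)
    then show "\<forall>\<^sub>F n in sequentially. \<forall>z\<in>UNIV. dist (s n z) (F z) < e"
    proof eventually_elim
      case (elim n)
      have "dist (s n z) (F z) \<le> 2 / a n" for z
      proof -
        have "dist (s n z) (F z) \<le> \<bar>Re (s n z - F z)\<bar> + \<bar>Im (s n z - F z)\<bar>"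
          unfolding dist_norm by (rule cmod_le)
        also have "\<dots> \<le> 1 / a n + 1 / a n"
          unfolding s_def by (intro add_mono) (simp_all add: r)
        finally show ?thesis by simp
      qed
      then show ?case using elim by (meson le_less_trans)
    qed
  qed
  ultimately show ?thesis by blast
qed

context
  fixes E :: "complex set \<Rightarrow> 'a::complex_banach \<Rightarrow>\<^sub>L 'a"
  assumes E: "spectral_measure E"
begin

private abbreviation I where "I \<equiv> simple_spectral_integral E"

text \<open>
  The defining sum runs over the values of the integrand; it may be regrouped along any finer finite
  Borel partition, given here as the level sets of \<open>q\<close>. Linearity and multiplicativity follow by
  writing two integrands over a common partition.
\<close>

lemma simple_integral_compose:
  assumes q: "simple_function borel q" and B: "finite B" "range q \<subseteq> B"
  shows "I (\<lambda>z. \<phi> (q z)) = (\<Sum>b\<in>B. \<phi> b *\<^sub>C E (q -` {b}))"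
proof -
  have "I (\<lambda>z. \<phi> (q z)) = (\<Sum>c\<in>\<phi> ` range q. \<Sum>b\<in>{b \<in> range q. \<phi> b = c}. \<phi> b *\<^sub>C E (q -` {b}))"
    unfolding simple_spectral_integral_def image_image
  proof (rule sum.cong[OF refl])
    fix c
    have "(\<lambda>z. \<phi> (q z)) -` {c} = (\<Union>b\<in>{b \<in> range q. \<phi> b = c}. q -` {b})"
      by auto
    also have "E \<dots> = (\<Sum>b\<in>{b \<in> range q. \<phi> b = c}. E (q -` {b}))"
      using simple_function_borel_finite_range[OF q] simple_function_borel_vimage[OF q]
      by (intro E_UN_disjoint[OF E]) (auto simp: disjoint_family_on_def)
    finally show "c *\<^sub>C E ((\<lambda>z. \<phi> (q z)) -` {c}) = (\<Sum>b\<in>{b \<in> range q. \<phi> b = c}. \<phi> b *\<^sub>C E (q -` {b}))"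
      by (simp add: scaleC.sum_right)
  qed
  also have "\<dots> = (\<Sum>b\<in>range q. \<phi> b *\<^sub>C E (q -` {b}))"
    using simple_function_borel_finite_range[OF q] by (intro sum.group) auto
  also have "\<dots> = (\<Sum>b\<in>B. \<phi> b *\<^sub>C E (q -` {b}))"
  proof (rule sum.mono_neutral_left[OF B])
    have "q -` {b} = {}" if "b \<notin> range q" for b using that by auto
    then show "\<forall>b\<in>B - range q. \<phi> b *\<^sub>C E (q -` {b}) = 0"
      by (auto simp: E_empty[OF E] scaleC.zero_right)
  qed
  finally show ?thesis .
qed

lemma simple_integral_range:
  assumes "simple_function borel q"
  shows "I (\<lambda>z. \<phi> (q z)) = (\<Sum>b\<in>range q. \<phi> b *\<^sub>C E (q -` {b}))"
  using simple_integral_compose[OF assms simple_function_borel_finite_range[OF assms]] by simp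

lemma simple_integral_diff:
  assumes "simple_function borel f" "simple_function borel g"
  shows "I (\<lambda>z. f z - g z) = I f - I g"
proof -
  have q: "simple_function borel (\<lambda>z. (f z, g z))" using assms by simp
  show ?thesis
    using simple_integral_range[OF q, of "\<lambda>p. fst p - snd p"]
      simple_integral_range[OF q, of fst] simple_integral_range[OF q, of snd]
    by (simp add: scaleC.diff_left sum_subtractf)
qed

text \<open>
  The projections of a partition are mutually orthogonal, so only the diagonal terms of the product
  of the two sums survive.
\<close>

lemma simple_integral_mult:
  assumes "simple_function borel f" "simple_function borel g"
  shows "I (\<lambda>z. f z * g z) = I f o\<^sub>L I g"
proof (rule blinfun_eqI)
  fix x
  define q where "q z = (f z, g z)" for z
  have q: "simple_function borel q" unfolding q_def using assms by simp
  note fin = simple_function_borel_finite_range[OF q]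
  have orth: "blinfun_apply (E (q -` {a})) (blinfun_apply (E (q -` {b})) x) =
      (if a = b then blinfun_apply (E (q -` {b})) x else 0)" for a b
  proof -
    have "q -` {a} \<inter> q -` {b} = (if a = b then q -` {b} else {})" by auto
    then show ?thesis
      using E_Int_apply[OF E simple_function_borel_vimage[OF q] simple_function_borel_vimage[OF q], of "{a}" "{b}" x]
      by (simp add: E_empty[OF E])
  qed
  have "blinfun_apply (I f o\<^sub>L I g) x = (\<Sum>a\<in>range q. fst a *\<^sub>C blinfun_apply (E (q -` {a}))
      (\<Sum>b\<in>range q. snd b *\<^sub>C blinfun_apply (E (q -` {b})) x))"
    using simple_integral_range[OF q, of fst] simple_integral_range[OF q, of snd]
    by (simp add: q_def blinfun.sum_left scaleC_blinfun.rep_eq)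
  also have "\<dots> = (\<Sum>a\<in>range q. fst a *\<^sub>C (\<Sum>b\<in>range q. if a = b then snd b *\<^sub>C blinfun_apply (E (q -` {b})) x else 0))"
    using simple_function_borel_vimage[OF q]
    by (simp add: blinfun.sum_right E_scaleC[OF E] orth if_distrib scaleC.zero_right cong: if_cong)
  also have "\<dots> = (\<Sum>a\<in>range q. (fst a * snd a) *\<^sub>C blinfun_apply (E (q -` {a})) x)"
    using fin by (simp add: scaleC_scaleC)
  also have "\<dots> = blinfun_apply (I (\<lambda>z. f z * g z)) x"
    using simple_integral_range[OF q, of "\<lambda>p. fst p * snd p"]
    by (simp add: q_def blinfun.sum_left scaleC_blinfun.rep_eq)
  finally show "blinfun_apply (I (\<lambda>z. f z * g z)) x = blinfun_apply (I f o\<^sub>L I g) x" by simp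
qed

lemma simple_integral_indicator:
  assumes "\<delta> \<in> sets borel"
  shows "I (indicator \<delta>) = E \<delta>"
proof -
  have q: "simple_function borel (\<lambda>z. z \<in> \<delta>)"
  proof -
    have "simple_function borel (\<lambda>z. if z \<in> \<delta> then True else False)"
      using assms by (intro simple_function_If_set) auto
    moreover have "(\<lambda>z. if z \<in> \<delta> then True else False) = (\<lambda>z. z \<in> \<delta>)" by auto
    ultimately show ?thesis by (simp only:)
  qed
  have "I (\<lambda>z. of_bool (z \<in> \<delta>)) = (\<Sum>b\<in>UNIV. of_bool b *\<^sub>C E ((\<lambda>z. z \<in> \<delta>) -` {b}))"
    by (rule simple_integral_compose[OF q]) simp_all
  also have "\<dots> = E \<delta>"
  proof -
    have "(\<lambda>z. z \<in> \<delta>) -` {True} = \<delta>" by auto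
    then show ?thesis by (simp add: UNIV_bool scaleC_one scaleC.zero_left)
  qed
  also have "(\<lambda>z. of_bool (z \<in> \<delta>)) = (indicator \<delta> :: complex \<Rightarrow> complex)"
    by (auto simp: indicator_def)
  finally show ?thesis .
qed

lemma simple_integral_one: "I (\<lambda>z. 1) = id_blinfun"
proof -
  have "(indicator UNIV :: complex \<Rightarrow> complex) = (\<lambda>z. 1)" by auto
  then show ?thesis
    using simple_integral_indicator[of UNIV] by (simp add: E_UNIV[OF E])
qed

lemma simple_integral_restrict:
  assumes f: "simple_function borel f" and \<delta>: "\<delta> \<in> sets borel"
  shows "I (\<lambda>z. if z \<in> \<delta> then f z else 0) = I f o\<^sub>L E \<delta>"
proof -
  have "I (\<lambda>z. f z * indicator \<delta> z) = I f o\<^sub>L I (indicator \<delta>)"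
    by (rule simple_integral_mult[OF f simple_function_indicator[OF \<delta>]])
  moreover have "(\<lambda>z. f z * indicator \<delta> z) = (\<lambda>z. if z \<in> \<delta> then f z else 0)"
    by (auto simp: indicator_def)
  ultimately show ?thesis by (simp add: simple_integral_indicator[OF \<delta>])
qed

lemma norm_simple_integral_le:
  assumes f: "simple_function borel f" and C: "\<And>z. cmod (f z) \<le> C"
  shows "norm (I f) \<le> 4 * measure_bound E * C"
  unfolding simple_spectral_integral_def
proof (rule norm_complex_combination_le)
  show fin: "finite (range f)" by (rule simple_function_borel_finite_range[OF f])
  show "0 \<le> C" using C norm_ge_zero order_trans by blast
  show "cmod c \<le> C" if "c \<in> range f" for c using that C by auto
  fix J assume "J \<subseteq> range f"
  then have "finite J" using fin by (rule finite_subset)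
  then have "(\<Sum>c\<in>J. E (f -` {c})) = E (\<Union>c\<in>J. f -` {c})"
    using simple_function_borel_vimage[OF f]
    by (intro E_UN_disjoint[OF E, symmetric]) (auto simp: disjoint_family_on_def)
  also have "(\<Union>c\<in>J. f -` {c}) = f -` J" by auto
  finally show "norm (\<Sum>c\<in>J. E (f -` {c})) \<le> measure_bound E"
    using norm_E_le[OF E simple_function_borel_vimage[OF f]] by simp
qed

lemma norm_simple_integral_E_le:
  assumes f: "simple_function borel f" and \<delta>: "\<delta> \<in> sets borel"
    and C: "\<And>z. z \<in> \<delta> \<Longrightarrow> cmod (f z) \<le> C" "0 \<le> C"
  shows "norm (I f o\<^sub>L E \<delta>) \<le> 4 * measure_bound E * C"
  unfolding simple_integral_restrict[OF f \<delta>, symmetric]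
  by (rule norm_simple_integral_le[OF simple_function_borel_restrict[OF f \<delta>]]) (use C in auto)

text \<open>
  For \<open>s = s'\<close> this is the Cauchy property, for different sequences it shows that the limit depends
  on \<open>F\<close> only. Both are used to see that the bounded integral is well defined.
\<close>

lemma simple_integral_limits_agree:
  assumes s: "\<And>n. simple_function borel (s n)" "uniform_limit UNIV s F sequentially"
    and s': "\<And>n. simple_function borel (s' n)" "uniform_limit UNIV s' F sequentially"
    and "0 < e"
  obtains N where "\<And>m n. N \<le> m \<Longrightarrow> N \<le> n \<Longrightarrow> norm (I (s m) - I (s' n)) < e"
proof -
  \<comment> \<open>Both functions are within \<open>d\<close> of \<open>F\<close>, hence within \<open>2 * d\<close> of each other, and integration has
    norm at most \<open>4 * measure_bound E\<close>. The summand 1 makes \<open>K\<close> positive.\<close>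
  define K where "K = 8 * measure_bound E + 1"
  have K: "0 < K" using measure_bound_nonneg[OF E] by (simp add: K_def)
  define d where "d = e / K"
  have d: "0 < d" using \<open>0 < e\<close> K by (simp add: d_def)
  obtain N1 where N1: "\<And>n z. N1 \<le> n \<Longrightarrow> dist (s n z) (F z) < d"
    using uniform_limitD[OF s(2) d] by (auto simp: eventually_sequentially)
  obtain N2 where N2: "\<And>n z. N2 \<le> n \<Longrightarrow> dist (s' n z) (F z) < d"
    using uniform_limitD[OF s'(2) d] by (auto simp: eventually_sequentially)
  have "norm (I (s m) - I (s' n)) < e" if "max N1 N2 \<le> m" "max N1 N2 \<le> n" for m n
  proof -
    have "cmod (s m z - s' n z) \<le> 2 * d" for z
      using N1[of m z] N2[of n z] that dist_triangle2[of "s m z" "s' n z" "F z"]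
      by (simp add: dist_norm)
    then have "norm (I (\<lambda>z. s m z - s' n z)) \<le> 4 * measure_bound E * (2 * d)"
      using s s' by (intro norm_simple_integral_le) auto
    also have "\<dots> < K * d" using d by (simp add: K_def)
    also have "\<dots> = e" using K by (simp add: d_def)
    finally show ?thesis by (simp add: simple_integral_diff[OF s(1) s'(1)])
  qed
  then show ?thesis using that by blast
qed

lemma bounded_spectral_integral_LIMSEQ:
  assumes s: "\<And>n. simple_function borel (s n)" "uniform_limit UNIV s F sequentially"
  shows "(\<lambda>n. I (s n)) \<longlonglongrightarrow> bounded_spectral_integral E F"
proof -
  have "Cauchy (\<lambda>n. I (s n))"
    unfolding Cauchy_def dist_norm using simple_integral_limits_agree[OF s s] by metis
  then obtain B where B: "(\<lambda>n. I (s n)) \<longlonglongrightarrow> B"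
    using Cauchy_convergent_iff convergent_def by blast
  have "bounded_spectral_integral E F = B"
    unfolding bounded_spectral_integral_def
  proof (rule the_equality)
    show "\<exists>s. (\<forall>n. simple_function borel (s n)) \<and> uniform_limit UNIV s F sequentially \<and>
        (\<lambda>n. I (s n)) \<longlonglongrightarrow> B"
      using s B by blast
    fix B'
    assume "\<exists>s. (\<forall>n. simple_function borel (s n)) \<and> uniform_limit UNIV s F sequentially \<and>
        (\<lambda>n. I (s n)) \<longlonglongrightarrow> B'"
    then obtain s' where s': "\<And>n. simple_function borel (s' n)" "uniform_limit UNIV s' F sequentially"
      and B': "(\<lambda>n. I (s' n)) \<longlonglongrightarrow> B'" by blast
    have "(\<lambda>n. I (s n) - I (s' n)) \<longlonglongrightarrow> 0"
    proof (rule LIMSEQ_I)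
      fix e :: real assume "0 < e"
      from simple_integral_limits_agree[OF s s' this] obtain N where
        "\<And>m n. N \<le> m \<Longrightarrow> N \<le> n \<Longrightarrow> norm (I (s m) - I (s' n)) < e" by metis
      then show "\<exists>N. \<forall>n\<ge>N. norm (I (s n) - I (s' n) - 0) < e" by auto
    qed
    moreover have "(\<lambda>n. I (s n) - I (s' n)) \<longlonglongrightarrow> B - B'"
      by (rule tendsto_diff[OF B B'])
    ultimately show "B' = B" using LIMSEQ_unique by fastforce
  qed
  with B show ?thesis by simp
qed

lemma bounded_spectral_integral_restrict:
  assumes F: "F \<in> borel_measurable borel" "\<And>z. cmod (F z) \<le> C" and \<delta>: "\<delta> \<in> sets borel"
  shows "bounded_spectral_integral E F o\<^sub>L E \<delta> =
    bounded_spectral_integral E (\<lambda>z. if z \<in> \<delta> then F z else 0)"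
proof -
  obtain s where s: "\<And>n. simple_function borel (s n)" "uniform_limit UNIV s F sequentially"
    using simple_approximation_exists[OF F] by blast
  have "uniform_limit UNIV (\<lambda>n z. if z \<in> \<delta> then s n z else 0) (\<lambda>z. if z \<in> \<delta> then F z else 0) sequentially"
  proof (rule uniform_limitI)
    fix e :: real assume "0 < e"
    then show "\<forall>\<^sub>F n in sequentially. \<forall>z\<in>UNIV. dist (if z \<in> \<delta> then s n z else 0) (if z \<in> \<delta> then F z else 0) < e"
      using uniform_limitD[OF s(2) \<open>0 < e\<close>] by (auto elim: eventually_mono)
  qed
  then have "(\<lambda>n. I (s n) o\<^sub>L E \<delta>) \<longlonglongrightarrow> bounded_spectral_integral E (\<lambda>z. if z \<in> \<delta> then F z else 0)"
    using bounded_spectral_integral_LIMSEQ[of "\<lambda>n z. if z \<in> \<delta> then s n z else 0"]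
    by (simp add: simple_integral_restrict[OF s(1) \<delta>] simple_function_borel_restrict[OF s(1) \<delta>])
  moreover have "(\<lambda>n. I (s n) o\<^sub>L E \<delta>) \<longlonglongrightarrow> (bounded_spectral_integral E F o\<^sub>L E \<delta>)"
    by (intro bounded_bilinear.tendsto[OF bounded_bilinear_blinfun_compose] tendsto_const
        bounded_spectral_integral_LIMSEQ s)
  ultimately show ?thesis by (rule LIMSEQ_unique[symmetric])
qed

lemma simple_integral_scaleC:
  assumes "simple_function borel f"
  shows "blinfun_apply (I f) (c *\<^sub>C x) = c *\<^sub>C blinfun_apply (I f) x"
  unfolding simple_spectral_integral_def
  using simple_function_borel_vimage[OF assms]
  by (simp add: blinfun.sum_left scaleC_blinfun.rep_eq E_scaleC[OF E] scaleC.sum_right scaleC_scaleC mult.commute)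

lemma bounded_spectral_integral_scaleC:
  assumes F: "F \<in> borel_measurable borel" "\<And>z. cmod (F z) \<le> C"
  shows "blinfun_apply (bounded_spectral_integral E F) (c *\<^sub>C x) =
    c *\<^sub>C blinfun_apply (bounded_spectral_integral E F) x"
proof -
  obtain s where s: "\<And>n. simple_function borel (s n)" "uniform_limit UNIV s F sequentially"
    using simple_approximation_exists[OF F] by blast
  note lim = bounded_spectral_integral_LIMSEQ[OF s]
  have "(\<lambda>n. blinfun_apply (I (s n)) (c *\<^sub>C x)) \<longlonglongrightarrow>
      blinfun_apply (bounded_spectral_integral E F) (c *\<^sub>C x)"
    by (intro blinfun.tendsto lim tendsto_const)
  moreover have "(\<lambda>n. c *\<^sub>C blinfun_apply (I (s n)) x) \<longlonglongrightarrow>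
      c *\<^sub>C blinfun_apply (bounded_spectral_integral E F) x"
    by (intro scaleC.tendsto blinfun.tendsto lim tendsto_const)
  ultimately show ?thesis
    by (simp add: simple_integral_scaleC[OF s(1)] LIMSEQ_unique)
qed

end

section \<open>Strongly continuous semigroups\<close>

lemma C0_semigroup_add:
  assumes "C0_semigroup T" "0 \<le> s" "0 \<le> t"
  shows "blinfun_apply (T (s + t)) x = blinfun_apply (T s) (blinfun_apply (T t) x)"
  using assms by (simp add: C0_semigroup_def)

text \<open>
  Otherwise there are times \<open>t n\<close> tending to 0 at which the norms are unbounded, while \<open>T (t n) x\<close>
  converges to \<open>x\<close> for every \<open>x\<close>, against the uniform boundedness principle.
\<close>

lemma C0_semigroup_bounded_near_0:
  assumes T: "C0_semigroup T"
  obtains \<eta> K where "0 < \<eta>" "\<And>t. 0 \<le> t \<Longrightarrow> t \<le> \<eta> \<Longrightarrow> norm (T t) \<le> K"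
proof -
  have "\<exists>\<eta>>0. \<exists>K. \<forall>t. 0 \<le> t \<and> t \<le> \<eta> \<longrightarrow> norm (T t) \<le> K"
  proof (rule ccontr)
    assume "\<not> ?thesis"
    then have "\<exists>t. 0 \<le> t \<and> t \<le> \<eta> \<and> K < norm (T t)" if "0 < \<eta>" for \<eta> K
      using that by (auto simp: not_le)
    then have "\<forall>n. \<exists>t. 0 \<le> t \<and> t \<le> inverse (real (Suc n)) \<and> real n < norm (T t)"
      by simp
    then have "\<exists>t. \<forall>n. 0 \<le> t n \<and> t n \<le> inverse (real (Suc n)) \<and> real n < norm (T (t n))"
      by (rule choice)
    then obtain t where t: "\<And>n. 0 \<le> t n" "\<And>n. t n \<le> inverse (real (Suc n))"
      and large: "\<And>n. real n < norm (T (t n))" by blast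
    have t_lim: "t \<longlonglongrightarrow> 0"
      using t by (intro tendsto_sandwich[OF _ _ tendsto_const LIMSEQ_inverse_real_of_nat]) auto
    have "\<exists>K. \<forall>f\<in>range (\<lambda>n. T (t n)). norm (blinfun_apply f x) \<le> K" for x
    proof -
      have "(\<lambda>n. blinfun_apply (T (t n)) x) \<longlonglongrightarrow> x"
      proof -
        have "((\<lambda>r. blinfun_apply (T r) x) \<longlongrightarrow> blinfun_apply (T 0) x) (at 0 within {0..})"
          using T by (simp add: C0_semigroup_def at_within_Ici_at_right)
        then have "continuous (at 0 within {0..}) (\<lambda>r. blinfun_apply (T r) x)"
          by (simp add: continuous_within)
        then have "(\<lambda>n. blinfun_apply (T (t n)) x) \<longlonglongrightarrow> blinfun_apply (T 0) x"
          by (rule continuous_within_tendsto_compose'[OF _ _ t_lim]) (use t in auto)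
        then show ?thesis using T by (simp add: C0_semigroup_def)
      qed
      then have "Bseq (\<lambda>n. blinfun_apply (T (t n)) x)"
        using convergentI convergent_imp_Bseq by blast
      then show ?thesis by (auto simp: Bseq_def)
    qed
    then obtain K where K: "\<And>f. f \<in> range (\<lambda>n. T (t n)) \<Longrightarrow> norm f \<le> K"
      using uniform_boundedness[of "range (\<lambda>n. T (t n))"] by blast
    obtain n where "K \<le> real n" using real_arch_simple by blast
    with large[of n] K[of "T (t n)"] show False by auto
  qed
  then show ?thesis using that by blast
qed

lemma C0_semigroup_bounded_on_interval:
  assumes T: "C0_semigroup T"
  obtains K where "0 \<le> K" "\<And>s. 0 \<le> s \<Longrightarrow> s \<le> t \<Longrightarrow> norm (T s) \<le> K"
proof -
  obtain \<eta> K where \<eta>: "0 < \<eta>" and K: "\<And>s. 0 \<le> s \<Longrightarrow> s \<le> \<eta> \<Longrightarrow> norm (T s) \<le> K"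
    using C0_semigroup_bounded_near_0[OF T] by blast
  have "\<exists>L\<ge>0. \<forall>s. 0 \<le> s \<and> s \<le> real n * \<eta> \<longrightarrow> norm (T s) \<le> L" for n
  proof (induction n)
    case 0
    then show ?case by (auto intro!: exI[of _ "norm (T 0)"])
  next
    case (Suc n)
    then obtain L where L: "0 \<le> L" "\<And>s. 0 \<le> s \<Longrightarrow> s \<le> real n * \<eta> \<Longrightarrow> norm (T s) \<le> L"
      by blast
    have "norm (T s) \<le> max L (L * K)" if s: "0 \<le> s" "s \<le> real (Suc n) * \<eta>" for s
    proof (cases "s \<le> real n * \<eta>")
      case True
      then show ?thesis using L(2)[of s] s by simp
    next
      case False
      define u where "u = s - real n * \<eta>"
      have u: "0 \<le> u" "u \<le> \<eta>" "s = real n * \<eta> + u"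
        using False s by (auto simp: u_def algebra_simps)
      have "T s = T (real n * \<eta>) o\<^sub>L T u"
        using T u \<eta> by (simp add: C0_semigroup_def)
      then have "norm (T s) \<le> norm (T (real n * \<eta>)) * norm (T u)"
        by (simp add: norm_blinfun_compose)
      also have "\<dots> \<le> L * K"
        using u \<eta> L by (intro mult_mono K L(2)) auto
      finally show ?thesis by simp
    qed
    then show ?case using L(1) by (intro exI[of _ "max L (L * K)"]) auto
  qed
  note bound = this
  obtain n where n: "t \<le> real n * \<eta>"
    using ex_less_of_nat_mult[OF \<eta>, of t] by (auto intro: less_imp_le)
  from bound[of n] obtain L where "0 \<le> L" "\<And>s. 0 \<le> s \<Longrightarrow> s \<le> real n * \<eta> \<Longrightarrow> norm (T s) \<le> L"
    by blast
  with n show ?thesis by (intro that[of L]) auto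
qed

text \<open>
  The time \<open>t - h\<close> approaches \<open>t\<close> from the left, where strong continuity at 0 does not apply
  directly. The semigroup law rewrites the difference as \<open>T (t - h) (f h - T h z)\<close>, and \<open>T (t - h)\<close>
  stays bounded.
\<close>

lemma C0_semigroup_left_limit:
  assumes T: "C0_semigroup T" and "0 < t" and f: "(f \<longlongrightarrow> z) (at_right 0)"
  shows "((\<lambda>h. blinfun_apply (T (t - h)) (f h)) \<longlongrightarrow> blinfun_apply (T t) z) (at_right 0)"
proof -
  obtain K where K: "0 \<le> K" "\<And>s. 0 \<le> s \<Longrightarrow> s \<le> t \<Longrightarrow> norm (T s) \<le> K"
    using C0_semigroup_bounded_on_interval[OF T] by blast
  have "((\<lambda>h. blinfun_apply (T h) z) \<longlongrightarrow> z) (at_right 0)"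
    using T by (simp add: C0_semigroup_def)
  from tendsto_diff[OF f this] have lim: "((\<lambda>h. K * norm (f h - blinfun_apply (T h) z)) \<longlongrightarrow> 0) (at_right 0)"
    by (auto intro: tendsto_mult_right_zero tendsto_norm_zero)
  have "\<forall>\<^sub>F h in at_right 0. h \<in> {0<..<t}"
    using \<open>0 < t\<close> by (rule eventually_at_right_real)
  then have "\<forall>\<^sub>F h in at_right 0. norm (blinfun_apply (T (t - h)) (f h) - blinfun_apply (T t) z)
      \<le> K * norm (f h - blinfun_apply (T h) z)"
  proof eventually_elim
    case (elim h)
    have "blinfun_apply (T t) z = blinfun_apply (T (t - h)) (blinfun_apply (T h) z)"
      using C0_semigroup_add[OF T, of "t - h" h z] elim by simp
    then have "norm (blinfun_apply (T (t - h)) (f h) - blinfun_apply (T t) z)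
        = norm (blinfun_apply (T (t - h)) (f h - blinfun_apply (T h) z))"
      by (simp add: blinfun.diff_right)
    also have "\<dots> \<le> norm (T (t - h)) * norm (f h - blinfun_apply (T h) z)"
      by (rule norm_blinfun)
    also have "\<dots> \<le> K * norm (f h - blinfun_apply (T h) z)"
      using elim by (intro mult_right_mono K) auto
    finally show ?case .
  qed
  from Lim_null_comparison[OF this lim] show ?thesis
    by (simp add: LIM_zero_iff)
qed

text \<open>
  The generator is a right derivative at 0. The right derivative at \<open>t\<close> follows by applying \<open>T t\<close>, the
  left one by \<open>C0_semigroup_left_limit\<close>, since the quotient at \<open>- h\<close> is \<open>T (t - h)\<close> applied to the
  quotient at 0.
\<close>

lemma C0_semigroup_has_vector_derivative:
  assumes T: "C0_semigroup T" and gen: "generates D A T" and "y \<in> D" and "0 < t"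
  shows "((\<lambda>r. blinfun_apply (T r) y) has_vector_derivative blinfun_apply (T t) (A y)) (at t)"
proof -
  define q where "q h = (1 / h) *\<^sub>R (blinfun_apply (T (t + h)) y - blinfun_apply (T t) y)" for h
  define g where "g h = (1 / h) *\<^sub>R (blinfun_apply (T h) y - y)" for h
  have g: "(g \<longlongrightarrow> A y) (at_right 0)"
    using gen \<open>y \<in> D\<close> by (simp add: generates_def g_def[abs_def])
  have "(q \<longlongrightarrow> blinfun_apply (T t) (A y)) (at_right 0)"
  proof (rule Lim_transform_eventually)
    show "((\<lambda>h. blinfun_apply (T t) (g h)) \<longlongrightarrow> blinfun_apply (T t) (A y)) (at_right 0)"
      by (intro blinfun.tendsto tendsto_const g)
    show "\<forall>\<^sub>F h in at_right 0. blinfun_apply (T t) (g h) = q h"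
      using eventually_at_right_less[of 0]
    proof eventually_elim
      case (elim h)
      then show ?case
        using C0_semigroup_add[OF T, of t h y] \<open>0 < t\<close>
        by (simp add: q_def g_def blinfun.diff_right blinfun.scaleR_right)
    qed
  qed
  moreover have "(q \<longlongrightarrow> blinfun_apply (T t) (A y)) (at_left 0)"
    unfolding filterlim_at_left_to_right[of _ _ 0] minus_zero
  proof (rule Lim_transform_eventually)
    show "((\<lambda>h. blinfun_apply (T (t - h)) (g h)) \<longlongrightarrow> blinfun_apply (T t) (A y)) (at_right 0)"
      by (rule C0_semigroup_left_limit[OF T \<open>0 < t\<close> g])
    show "\<forall>\<^sub>F h in at_right 0. blinfun_apply (T (t - h)) (g h) = q (- h)"
      using eventually_at_right_real[OF \<open>0 < t\<close>]
    proof eventually_elim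
      case (elim h)
      then have "blinfun_apply (T t) y = blinfun_apply (T (t - h)) (blinfun_apply (T h) y)"
        using C0_semigroup_add[OF T, of "t - h" h y] by simp
      then show ?case
        by (simp add: q_def g_def blinfun.diff_right blinfun.scaleR_right blinfun.minus_right
            scaleR_diff_right)
    qed
  qed
  ultimately have "(q \<longlongrightarrow> blinfun_apply (T t) (A y)) (at 0)"
    by (simp add: filterlim_at_split)
  then have "((\<lambda>h. norm (q h - blinfun_apply (T t) (A y))) \<longlongrightarrow> 0) (at 0)"
    by (intro tendsto_norm_zero) (simp add: LIM_zero_iff)
  then have "((\<lambda>h. norm (blinfun_apply (T (t + h)) y - blinfun_apply (T t) y
      - h *\<^sub>R blinfun_apply (T t) (A y)) / norm h) \<longlongrightarrow> 0) (at 0)"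
  proof (rule Lim_transform_eventually)
    have "norm (q h - v) = norm (blinfun_apply (T (t + h)) y - blinfun_apply (T t) y - h *\<^sub>R v) / norm h"
      if "h \<noteq> 0" for h v
    proof -
      have "q h - v = (1 / h) *\<^sub>R (blinfun_apply (T (t + h)) y - blinfun_apply (T t) y - h *\<^sub>R v)"
        using that by (simp add: q_def scaleR_diff_right)
      then show ?thesis by simp
    qed
    note quotient = this
    show "\<forall>\<^sub>F h in at 0. norm (q h - blinfun_apply (T t) (A y)) = norm (blinfun_apply (T (t + h)) y
        - blinfun_apply (T t) y - h *\<^sub>R blinfun_apply (T t) (A y)) / norm h"
      by (rule eventually_mono[OF eventually_neq_at_within]) (rule quotient)
  qed
  then show ?thesis
    unfolding has_vector_derivative_def has_derivative_at
    by (simp add: bounded_linear_scaleR_left)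
qed

lemma C0_semigroup_orbit_continuous_on:
  assumes T: "C0_semigroup T" and "generates D A T" "y \<in> D"
  shows "continuous_on {0..} (\<lambda>r. blinfun_apply (T r) y)"
proof -
  have "continuous (at r within {0..}) (\<lambda>r. blinfun_apply (T r) y)" if "0 \<le> r" for r
  proof (cases "r = 0")
    case True
    then show ?thesis
      using T by (simp add: continuous_within C0_semigroup_def at_within_Ici_at_right)
  next
    case False
    with that have "0 < r" by simp
    from C0_semigroup_has_vector_derivative[OF assms this] show ?thesis
      by (rule has_vector_derivative_continuous[OF has_vector_derivative_at_within])
  qed
  then show ?thesis
    unfolding continuous_on_eq_continuous_within by (simp del: continuous_within)
qed

section \<open>The semigroup on bounded spectral subspaces\<close>

text \<open>
  The integrand of \<open>A\<close> restricted to the spectral subspace of \<open>\<delta>\<close>.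
\<close>

definition identity_on :: "complex set \<Rightarrow> complex \<Rightarrow> complex" where
  "identity_on \<delta> z = (if z \<in> \<delta> then z else 0)"

lemma identity_on_borel:
  assumes [measurable]: "\<delta> \<in> sets borel"
  shows "identity_on \<delta> \<in> borel_measurable borel"
  unfolding identity_on_def[abs_def] by measurable

lemma simple_approximation_identity_on:
  assumes "\<delta> \<in> sets borel" "\<delta> \<subseteq> cball 0 r"
  shows "\<exists>s. (\<forall>n. simple_function borel (s n)) \<and> uniform_limit UNIV s (identity_on \<delta>) sequentially"
proof (rule simple_approximation_exists[OF identity_on_borel[OF assms(1)]])
  show "cmod (identity_on \<delta> z) \<le> \<bar>r\<bar>" for z
    using assms(2) by (auto simp: identity_on_def intro: order_trans)
qed

lemma uniform_limit_identity_on_Re: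
  assumes "uniform_limit UNIV s (identity_on \<delta>) sequentially" "0 < e"
  shows "\<forall>\<^sub>F n in sequentially. \<forall>z\<in>\<delta>. \<bar>Re (s n z) - Re z\<bar> < e"
  using uniform_limitD[OF assms]
proof eventually_elim
  case (elim n)
  show ?case
  proof
    fix z assume "z \<in> \<delta>"
    then have "cmod (s n z - z) < e"
      using elim by (simp add: dist_norm identity_on_def split: if_splits)
    then show "\<bar>Re (s n z) - Re z\<bar> < e"
      using abs_Re_le_cmod[of "s n z - z"] by simp
  qed
qed

text \<open>
  Once the truncation radius exceeds \<open>r\<close>, cutting the truncated integrand down to \<open>\<delta>\<close> leaves
  \<open>identity_on \<delta>\<close>. The sequence that defines \<open>A x\<close> is therefore eventually constant.
\<close>

lemma scalar_type_on_bounded_spectral_subspace: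
  assumes A: "scalar_type_spectral_operator D A E"
    and \<delta>: "\<delta> \<in> sets borel" "\<delta> \<subseteq> spectrum D A" "\<delta> \<subseteq> cball 0 r"
    and x: "blinfun_apply (E \<delta>) x = x"
  shows "x \<in> D" and "A x = blinfun_apply (bounded_spectral_integral E (identity_on \<delta>)) x"
proof -
  have E: "spectral_measure E" and supp: "spectral_support E = spectrum D A"
    and D: "D = {x. convergent (\<lambda>n. blinfun_apply (truncated_spectral_integral E (spectrum D A) n) x)}"
    and lim: "\<And>x. x \<in> D \<Longrightarrow> (\<lambda>n. blinfun_apply (truncated_spectral_integral E (spectrum D A) n) x) \<longlonglongrightarrow> A x"
    using A unfolding scalar_type_spectral_operator_def by blast+
  let ?S = "spectrum D A"
  let ?B = "bounded_spectral_integral E (identity_on \<delta>)"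
  have S: "?S \<in> sets borel"
    using closed_spectral_support[OF E] by (simp add: supp)
  obtain N where N: "r \<le> real N" using real_arch_simple by blast
  have "blinfun_apply (truncated_spectral_integral E ?S n) x = blinfun_apply ?B x" if "N \<le> n" for n
  proof -
    let ?F = "\<lambda>z. if z \<in> ?S \<and> cmod z \<le> real n then z else 0"
    have "?F = identity_on (?S \<inter> cball 0 (real n))"
      by (auto simp: identity_on_def)
    then have F: "?F \<in> borel_measurable borel"
      using identity_on_borel[of "?S \<inter> cball 0 (real n)"] S by simp
    have "truncated_spectral_integral E ?S n o\<^sub>L E \<delta> =
        bounded_spectral_integral E (\<lambda>z. if z \<in> \<delta> then ?F z else 0)"
      unfolding truncated_spectral_integral_def
      by (rule bounded_spectral_integral_restrict[OF E F _ \<delta>(1), of "real n"]) auto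
    also have "(\<lambda>z. if z \<in> \<delta> then ?F z else 0) = identity_on \<delta>"
    proof
      fix z
      have "z \<in> ?S \<and> cmod z \<le> real n" if "z \<in> \<delta>"
        using \<delta>(2,3) that N \<open>N \<le> n\<close> by force
      then show "(if z \<in> \<delta> then ?F z else 0) = identity_on \<delta> z"
        by (auto simp: identity_on_def)
    qed
    finally have "blinfun_apply (truncated_spectral_integral E ?S n) (blinfun_apply (E \<delta>) x) = blinfun_apply ?B x"
      by (metis blinfun_apply_blinfun_compose x)
    then show ?thesis by (simp add: x)
  qed
  then have conv: "(\<lambda>n. blinfun_apply (truncated_spectral_integral E ?S n) x) \<longlonglongrightarrow> blinfun_apply ?B x"
    by (intro tendsto_eventually) (auto simp: eventually_sequentially)
  then show "x \<in> D"
    by (subst D) (auto simp: convergent_def)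
  from LIMSEQ_unique[OF lim[OF this] conv] show "A x = blinfun_apply ?B x" .
qed

text \<open>
  The function \<open>w r = T (t - r) (I (exp (r * f)) x)\<close> joins \<open>T t x\<close> at \<open>r = 0\<close> to \<open>I (exp (t * f)) x\<close> at
  \<open>r = t\<close>. Its derivative is \<open>T (t - r) ((I f - B) (I (exp (r * f)) x))\<close>, because the generator acts on
  the subspace as \<open>B\<close>. The claim is the mean value inequality for \<open>w\<close>.
\<close>

lemma norm_semigroup_minus_exp_simple_le:
  fixes T :: "real \<Rightarrow> 'a::complex_banach \<Rightarrow>\<^sub>L 'a"
  assumes A: "scalar_type_spectral_operator D A E"
    and T: "C0_semigroup T" and gen: "generates D A T"
    and \<delta>: "\<delta> \<in> sets borel" "\<delta> \<subseteq> spectrum D A" "\<delta> \<subseteq> cball 0 r"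
    and x: "blinfun_apply (E \<delta>) x = x"
    and f: "simple_function borel f" "\<And>z. cmod (f z) \<le> C"
    and t: "0 < t" and K: "\<And>s. 0 \<le> s \<Longrightarrow> s \<le> t \<Longrightarrow> norm (T s) \<le> K"
  defines "B \<equiv> bounded_spectral_integral E (identity_on \<delta>)"
  shows "norm (blinfun_apply (T t) x - blinfun_apply (simple_spectral_integral E (\<lambda>z. exp (t * f z))) x)
    \<le> K * (norm (simple_spectral_integral E f - B) * (4 * measure_bound E * exp (t * C) * norm x)) * t"
proof -
  have E: "spectral_measure E"
    using A unfolding scalar_type_spectral_operator_def by blast
  let ?I = "simple_spectral_integral E"
  \<comment> \<open>The components of \<open>x\<close> along the level sets of \<open>f\<close> lie in the domain of the generator, so \<open>w\<close> can
    be differentiated term by term.\<close>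
  define y where "y b = blinfun_apply (E (f -` {b})) x" for b
  define R where "R = range f"
  define v where "v s = blinfun_apply (?I (\<lambda>z. exp (of_real s * f z))) x" for s
  define w where "w s = (\<Sum>b\<in>R. exp (of_real s * b) *\<^sub>C blinfun_apply (T (t - s)) (y b))" for s
  define w' where "w' s = blinfun_apply (T (t - s)) (blinfun_apply (?I f - B) (v s))" for s
  note vimage = simple_function_borel_vimage[OF f(1)]
  have "finite R" unfolding R_def by (rule simple_function_borel_finite_range[OF f(1)])
  have K0: "0 \<le> K" using K[of 0] t norm_ge_zero[of "T 0"] by linarith
  have "cmod (f 0) \<le> C" by (rule f(2))
  then have C0: "0 \<le> C" using norm_ge_zero[of "f 0"] by linarith
  have \<phi>: "blinfun_apply (?I (\<lambda>z. \<phi> (f z))) x = (\<Sum>b\<in>R. \<phi> b *\<^sub>C y b)" for \<phi>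
    by (simp add: simple_integral_range[OF E f(1)] R_def y_def blinfun.sum_left scaleC_blinfun.rep_eq)
  have T_scaleC: "blinfun_apply (T s) (c *\<^sub>C u) = c *\<^sub>C blinfun_apply (T s) u" if "0 \<le> s" for s c u
    using T that by (simp add: C0_semigroup_def complex_homogeneous_def)
  have B_scaleC: "blinfun_apply B (c *\<^sub>C u) = c *\<^sub>C blinfun_apply B u" for c u
  proof -
    have "cmod (identity_on \<delta> z) \<le> \<bar>r\<bar>" for z
      using \<delta>(3) by (auto simp: identity_on_def intro: order_trans)
    then show ?thesis
      unfolding B_def by (rule bounded_spectral_integral_scaleC[OF E identity_on_borel[OF \<delta>(1)]])
  qed
  have "blinfun_apply (E \<delta>) (y b) = y b" for b
    using E_Int_apply[OF E \<delta>(1) vimage, of "{b}" x] E_Int_apply[OF E vimage \<delta>(1), of "{b}" x]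
    by (simp add: y_def x Int_commute)
  then have y: "y b \<in> D" "A (y b) = blinfun_apply B (y b)" for b
    unfolding B_def using scalar_type_on_bounded_spectral_subspace[OF A \<delta>] by auto

  have v_bound: "norm (v s) \<le> 4 * measure_bound E * exp (t * C) * norm x" if "0 \<le> s" "s \<le> t" for s
  proof -
    have "norm (?I (\<lambda>z. exp (of_real s * f z))) \<le> 4 * measure_bound E * exp (t * C)"
    proof (rule norm_simple_integral_le[OF E])
      show "simple_function borel (\<lambda>z. exp (of_real s * f z))"
        by (rule simple_function_compose1[OF f(1)])
      fix z
      have "s * Re (f z) \<le> s * C"
        using that f(2)[of z] complex_Re_le_cmod[of "f z"] by (intro mult_left_mono) auto
      also have "\<dots> \<le> t * C" using that C0 by (intro mult_right_mono)
      finally show "cmod (exp (of_real s * f z)) \<le> exp (t * C)" by simp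
    qed
    then show ?thesis
      unfolding v_def by (intro order_trans[OF norm_blinfun] mult_right_mono) auto
  qed
  have w_deriv: "(w has_vector_derivative w' s) (at s)" if s: "0 < s" "s < t" for s
  proof -
    have term_deriv: "((\<lambda>s. exp (of_real s * b) *\<^sub>C blinfun_apply (T (t - s)) (y b)) has_vector_derivative
        exp (of_real s * b) *\<^sub>C (- blinfun_apply (T (t - s)) (blinfun_apply B (y b)))
        + (b * exp (of_real s * b)) *\<^sub>C blinfun_apply (T (t - s)) (y b)) (at s)" for b
    proof (rule scaleC.has_vector_derivative)
      have "((\<lambda>r. blinfun_apply (T r) (y b)) \<circ> (\<lambda>s. t - s) has_vector_derivative
          (- 1) *\<^sub>R blinfun_apply (T (t - s)) (A (y b))) (at s)"
      proof (rule vector_diff_chain_at)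
        show "((\<lambda>s. t - s) has_vector_derivative - 1) (at s)"
          by (auto intro!: derivative_eq_intros)
        show "((\<lambda>r. blinfun_apply (T r) (y b)) has_vector_derivative blinfun_apply (T (t - s)) (A (y b))) (at (t - s))"
          using s by (intro C0_semigroup_has_vector_derivative[OF T gen y(1)]) simp
      qed
      then show "((\<lambda>s. blinfun_apply (T (t - s)) (y b)) has_vector_derivative
          - blinfun_apply (T (t - s)) (blinfun_apply B (y b))) (at s)"
        by (simp add: o_def y(2))
      have "((\<lambda>z. exp (z * b)) has_field_derivative b * exp (of_real s * b)) (at (of_real s))"
        by (auto intro!: derivative_eq_intros)
      from has_vector_derivative_real_field[OF this]
      show "((\<lambda>s. exp (of_real s * b)) has_vector_derivative b * exp (of_real s * b)) (at s)" .
    qed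
    have "(w has_vector_derivative (\<Sum>b\<in>R. exp (of_real s * b) *\<^sub>C (- blinfun_apply (T (t - s)) (blinfun_apply B (y b)))
        + (b * exp (of_real s * b)) *\<^sub>C blinfun_apply (T (t - s)) (y b))) (at s)"
      unfolding w_def[abs_def] by (intro has_vector_derivative_sum term_deriv)
    also have "(\<Sum>b\<in>R. exp (of_real s * b) *\<^sub>C (- blinfun_apply (T (t - s)) (blinfun_apply B (y b)))
        + (b * exp (of_real s * b)) *\<^sub>C blinfun_apply (T (t - s)) (y b)) = w' s"
    proof -
      have fv: "blinfun_apply (?I f) (v s) = (\<Sum>b\<in>R. (b * exp (of_real s * b)) *\<^sub>C y b)"
        using \<phi>[of "\<lambda>b. b * exp (of_real s * b)"]
          simple_integral_mult[OF E f(1) simple_function_compose1[OF f(1)], of "\<lambda>b. exp (of_real s * b)"]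
        by (simp add: v_def)
      have Bv: "blinfun_apply B (v s) = (\<Sum>b\<in>R. exp (of_real s * b) *\<^sub>C blinfun_apply B (y b))"
        using \<phi>[of "\<lambda>b. exp (of_real s * b)"] by (simp add: v_def blinfun.sum_right B_scaleC)
      show ?thesis
        using s unfolding w'_def blinfun.diff_left fv Bv
        by (simp add: blinfun.diff_right blinfun.sum_right T_scaleC sum_subtractf scaleC.minus_right)
    qed
    finally show ?thesis .
  qed
  have w_cont: "continuous_on {0..t} w"
    unfolding w_def[abs_def]
  proof (intro continuous_on_sum scaleC.continuous_on)
    fix b
    show "continuous_on {0..t} (\<lambda>s. exp (complex_of_real s * b))"
      by (intro continuous_intros)
    show "continuous_on {0..t} (\<lambda>s. blinfun_apply (T (t - s)) (y b))"
      by (rule continuous_on_compose2[OF C0_semigroup_orbit_continuous_on[OF T gen y(1)]])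
        (auto intro!: continuous_intros)
  qed
  define M where "M = K * (norm (?I f - B) * (4 * measure_bound E * exp (t * C) * norm x))"
  have "norm (w t - w 0) \<le> M * t - M * 0"
  proof (rule differentiable_bound_general[OF t w_cont _ w_deriv])
    show "continuous_on {0..t} ((*) M)" by (intro continuous_intros)
    show "((*) M has_vector_derivative M) (at s)" for s
      by (auto intro!: derivative_eq_intros)
    fix s assume s: "0 < s" "s < t"
    have "norm (w' s) \<le> norm (T (t - s)) * (norm (?I f - B) * norm (v s))"
      unfolding w'_def by (intro order_trans[OF norm_blinfun] mult_left_mono norm_blinfun) auto
    also have "\<dots> \<le> M"
      unfolding M_def using s K0 by (intro mult_mono K v_bound mult_left_mono) auto
    finally show "norm (w' s) \<le> M" .
  qed
  moreover have "w 0 = blinfun_apply (T t) x"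
  proof -
    have "(\<Sum>b\<in>R. y b) = blinfun_apply (?I (\<lambda>z. 1)) x"
      using \<phi>[of "\<lambda>_. 1"] by (simp add: scaleC_one)
    also have "\<dots> = x"
      by (simp add: simple_integral_one[OF E])
    finally show ?thesis
      by (simp add: w_def scaleC_one flip: blinfun.sum_right)
  qed
  moreover have "w t = v t"
  proof -
    have "T 0 = id_blinfun" using T by (simp add: C0_semigroup_def)
    then show ?thesis
      using \<phi>[of "\<lambda>b. exp (of_real t * b)"] by (simp add: w_def v_def)
  qed
  ultimately show ?thesis
    by (simp add: M_def v_def norm_minus_commute)
qed

text \<open>
  This stands in for the functional calculus formula \<open>T t x = (\<integral> exp (t * z) dE z) x\<close>.
\<close>

lemma semigroup_eq_exp_limit:
  assumes A: "scalar_type_spectral_operator D A E"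
    and T: "C0_semigroup T" and gen: "generates D A T"
    and \<delta>: "\<delta> \<in> sets borel" "\<delta> \<subseteq> spectrum D A" "\<delta> \<subseteq> cball 0 r"
    and x: "blinfun_apply (E \<delta>) x = x" and t: "0 < t"
    and s: "\<And>n. simple_function borel (s n)" "uniform_limit UNIV s (identity_on \<delta>) sequentially"
  shows "(\<lambda>n. blinfun_apply (simple_spectral_integral E (\<lambda>z. exp (t * s n z))) x) \<longlonglongrightarrow> blinfun_apply (T t) x"
proof -
  have E: "spectral_measure E"
    using A unfolding scalar_type_spectral_operator_def by blast
  let ?B = "bounded_spectral_integral E (identity_on \<delta>)"
  obtain K where K: "\<And>u. 0 \<le> u \<Longrightarrow> u \<le> t \<Longrightarrow> norm (T u) \<le> K"
    using C0_semigroup_bounded_on_interval[OF T] by metis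
  define C where "C = \<bar>r\<bar> + 1"
  have "\<forall>\<^sub>F n in sequentially. \<forall>z. cmod (s n z) \<le> C"
    using uniform_limitD[OF s(2) zero_less_one]
  proof eventually_elim
    case (elim n)
    have "cmod (s n z) \<le> C" for z
    proof -
      have "cmod (identity_on \<delta> z) \<le> \<bar>r\<bar>"
        using \<delta>(3) by (auto simp: identity_on_def intro: order_trans)
      moreover have "cmod (s n z - identity_on \<delta> z) < 1"
        using elim by (simp add: dist_norm)
      ultimately show ?thesis
        unfolding C_def using norm_triangle_sub[of "s n z" "identity_on \<delta> z"] by linarith
    qed
    then show ?case ..
  qed
  then have "\<forall>\<^sub>F n in sequentially.
      norm (blinfun_apply (simple_spectral_integral E (\<lambda>z. exp (t * s n z))) x - blinfun_apply (T t) x)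
      \<le> K * (norm (simple_spectral_integral E (s n) - ?B) * (4 * measure_bound E * exp (t * C) * norm x)) * t"
  proof eventually_elim
    case (elim n)
    then show ?case
      using norm_semigroup_minus_exp_simple_le[OF A T gen \<delta> x s(1)[of n] _ t K, of C]
      by (simp add: norm_minus_commute)
  qed
  moreover have "(\<lambda>n. K * (norm (simple_spectral_integral E (s n) - ?B)
      * (4 * measure_bound E * exp (t * C) * norm x)) * t) \<longlonglongrightarrow> 0"
  proof -
    have "(\<lambda>n. norm (simple_spectral_integral E (s n) - ?B)) \<longlonglongrightarrow> 0"
      using bounded_spectral_integral_LIMSEQ[OF E s] by (simp add: LIM_zero tendsto_norm_zero)
    then show ?thesis
      by (intro tendsto_mult_left_zero tendsto_mult_right_zero)
  qed
  ultimately have "(\<lambda>n. blinfun_apply (simple_spectral_integral E (\<lambda>z. exp (t * s n z))) x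
      - blinfun_apply (T t) x) \<longlonglongrightarrow> 0"
    by (rule Lim_null_comparison)
  then show ?thesis by (simp add: LIM_zero_iff)
qed

section \<open>Spectral bound and growth bound\<close>

lemma le_exp_limit:
  fixes a b c :: real
  assumes "\<And>e. 0 < e \<Longrightarrow> a \<le> b * exp (c + d * e)"
  shows "a \<le> b * exp c"
proof -
  have "((\<lambda>e. b * exp (c + d * e)) \<longlongrightarrow> b * exp (c + d * 0)) (at_right 0)"
    by (intro tendsto_intros)
  moreover have "\<forall>\<^sub>F e in at_right 0. a \<le> b * exp (c + d * e)"
    using assms by (auto intro: eventually_mono[OF eventually_at_right_less])
  ultimately have "a \<le> b * exp (c + d * 0)"
    by (intro tendsto_lowerbound[where F = "at_right (0::real)"]) auto
  then show ?thesis by simp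
qed

context
  fixes D A and E :: "complex set \<Rightarrow> 'a::complex_banach \<Rightarrow>\<^sub>L 'a" and T
  assumes A: "scalar_type_spectral_operator D A E"
    and T: "C0_semigroup T" and gen: "generates D A T"
begin

lemma scalar_type_spectral_measure: "spectral_measure E"
  using A unfolding scalar_type_spectral_operator_def by blast

lemma scalar_type_support: "spectral_support E = spectrum D A"
  using A unfolding scalar_type_spectral_operator_def by blast

lemma scalar_type_spectrum_borel: "spectrum D A \<in> sets borel"
  using closed_spectral_support[OF scalar_type_spectral_measure] by (simp add: scalar_type_support)

lemma E_spectrum: "E (spectrum D A) = id_blinfun"
  using E_spectral_support[OF scalar_type_spectral_measure] by (simp add: scalar_type_support)

text \<open>
  On \<open>\<delta>\<close> the simple functions have real part at most \<open>\<sigma> + e\<close> eventually, which bounds the integrals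
  of their exponentials; values outside \<open>\<delta>\<close> do not count because \<open>x\<close> is fixed by \<open>E \<delta>\<close>.
\<close>

lemma norm_semigroup_le_on_bounded_spectral_subspace:
  assumes \<delta>: "\<delta> \<in> sets borel" "\<delta> \<subseteq> spectrum D A" "\<delta> \<subseteq> cball 0 r"
    and x: "blinfun_apply (E \<delta>) x = x" and t: "0 < t"
    and \<sigma>: "\<And>z. z \<in> \<delta> \<Longrightarrow> Re z \<le> \<sigma>"
  shows "norm (blinfun_apply (T t) x) \<le> 4 * measure_bound E * norm x * exp (t * \<sigma>)"
proof (rule le_exp_limit)
  fix e :: real assume "0 < e"
  note E = scalar_type_spectral_measure
  obtain s where s: "\<And>n. simple_function borel (s n)" "uniform_limit UNIV s (identity_on \<delta>) sequentially"
    using simple_approximation_identity_on[OF \<delta>(1,3)] by blast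
  let ?J = "\<lambda>n. simple_spectral_integral E (\<lambda>z. exp (t * s n z))"
  have simple: "simple_function borel (\<lambda>z. exp (t * s n z))" for n
    by (rule simple_function_compose1[OF s(1)])
  have "\<forall>\<^sub>F n in sequentially. norm (blinfun_apply (?J n) x) \<le> 4 * measure_bound E * norm x * exp (t * \<sigma> + t * e)"
    using uniform_limit_identity_on_Re[OF s(2) \<open>0 < e\<close>]
  proof eventually_elim
    case (elim n)
    have "norm (?J n o\<^sub>L E \<delta>) \<le> 4 * measure_bound E * exp (t * (\<sigma> + e))"
    proof (rule norm_simple_integral_E_le[OF E simple \<delta>(1)])
      fix z assume "z \<in> \<delta>"
      then have "\<bar>Re (s n z) - Re z\<bar> < e" using elim by blast
      then have "Re (s n z) \<le> \<sigma> + e" using \<sigma>[OF \<open>z \<in> \<delta>\<close>] by linarith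
      then show "cmod (exp (t * s n z)) \<le> exp (t * (\<sigma> + e))"
        using t by simp
    qed simp
    then have "norm (?J n o\<^sub>L E \<delta>) * norm x \<le> 4 * measure_bound E * exp (t * (\<sigma> + e)) * norm x"
      by (intro mult_right_mono) auto
    with norm_blinfun[of "?J n o\<^sub>L E \<delta>" x] show ?case
      by (simp add: x distrib_left mult_ac)
  qed
  moreover have "(\<lambda>n. norm (blinfun_apply (?J n) x)) \<longlonglongrightarrow> norm (blinfun_apply (T t) x)"
    by (intro tendsto_norm semigroup_eq_exp_limit[OF A T gen \<delta> x t s])
  ultimately show "norm (blinfun_apply (T t) x) \<le> 4 * measure_bound E * norm x * exp (t * \<sigma> + t * e)"
    by (intro tendsto_upperbound) auto
qed

text \<open>
  The integral of \<open>exp (- t * s n)\<close> inverts that of \<open>exp (t * s n)\<close> and recovers \<open>x\<close> from a vector close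
  to \<open>T t x\<close>; its norm on the range of \<open>E \<delta>\<close> is governed by a lower bound of the real parts.
\<close>

lemma norm_le_semigroup_on_bounded_spectral_subspace:
  assumes \<delta>: "\<delta> \<in> sets borel" "\<delta> \<subseteq> spectrum D A" "\<delta> \<subseteq> cball 0 r"
    and x: "blinfun_apply (E \<delta>) x = x" and t: "0 < t"
    and \<sigma>: "\<And>z. z \<in> \<delta> \<Longrightarrow> \<sigma> \<le> Re z"
  shows "norm x \<le> 4 * measure_bound E * norm (blinfun_apply (T t) x) * exp (- t * \<sigma>)"
proof (rule le_exp_limit)
  fix e :: real assume "0 < e"
  note E = scalar_type_spectral_measure
  obtain s where s: "\<And>n. simple_function borel (s n)" "uniform_limit UNIV s (identity_on \<delta>) sequentially"
    using simple_approximation_identity_on[OF \<delta>(1,3)] by blast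
  let ?J = "\<lambda>n. simple_spectral_integral E (\<lambda>z. exp (t * s n z))"
  let ?J' = "\<lambda>n. simple_spectral_integral E (\<lambda>z. exp (- (t * s n z)))"
  have simple: "simple_function borel (\<lambda>z. exp (t * s n z))"
    "simple_function borel (\<lambda>z. exp (- (t * s n z)))" for n
    by (rule simple_function_compose1[OF s(1)])+
  have "\<forall>\<^sub>F n in sequentially. norm x \<le>
      4 * measure_bound E * norm (blinfun_apply (?J n) x) * exp (- t * \<sigma> + t * e)"
    using uniform_limit_identity_on_Re[OF s(2) \<open>0 < e\<close>]
  proof eventually_elim
    case (elim n)
    have bound: "norm (?J' n o\<^sub>L E \<delta>) \<le> 4 * measure_bound E * exp (- t * \<sigma> + t * e)"
    proof (rule norm_simple_integral_E_le[OF E simple(2) \<delta>(1)])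
      fix z assume "z \<in> \<delta>"
      then have "\<bar>Re (s n z) - Re z\<bar> < e" using elim by blast
      then have "\<sigma> - e \<le> Re (s n z)" using \<sigma>[OF \<open>z \<in> \<delta>\<close>] by linarith
      then have "t * (\<sigma> - e) \<le> t * Re (s n z)" using t by simp
      then show "cmod (exp (- (t * s n z))) \<le> exp (- t * \<sigma> + t * e)"
        by (simp add: right_diff_distrib)
    qed simp
    have inverse: "blinfun_apply (?J' n o\<^sub>L E \<delta>) (blinfun_apply (?J n) x) = x"
    proof -
      have "E \<delta> o\<^sub>L ?J n = ?J n o\<^sub>L E \<delta>"
        using simple_integral_mult[OF E simple(1) simple_function_indicator[OF \<delta>(1)]]
          simple_integral_mult[OF E simple_function_indicator[OF \<delta>(1)] simple(1)]
        by (simp add: simple_integral_indicator[OF E \<delta>(1)] mult.commute)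
      then have "blinfun_apply (E \<delta>) (blinfun_apply (?J n) x) = blinfun_apply (?J n) x"
        by (metis blinfun_apply_blinfun_compose x)
      moreover have "?J' n o\<^sub>L ?J n = id_blinfun"
        using simple_integral_mult[OF E simple(2) simple(1), of n n]
        by (simp add: simple_integral_one[OF E] flip: exp_add)
      then have "blinfun_apply (?J' n) (blinfun_apply (?J n) x) = x"
        by (metis blinfun_apply_blinfun_compose blinfun_apply_id_blinfun id_apply)
      ultimately show ?thesis by simp
    qed
    have "norm x \<le> norm (?J' n o\<^sub>L E \<delta>) * norm (blinfun_apply (?J n) x)"
      using norm_blinfun[of "?J' n o\<^sub>L E \<delta>" "blinfun_apply (?J n) x"] unfolding inverse .
    also have "\<dots> \<le> 4 * measure_bound E * exp (- t * \<sigma> + t * e) * norm (blinfun_apply (?J n) x)"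
      using bound by (rule mult_right_mono) simp
    finally show ?case by (simp add: mult_ac)
  qed
  moreover have "(\<lambda>n. 4 * measure_bound E * norm (blinfun_apply (?J n) x) * exp (- t * \<sigma> + t * e)) \<longlonglongrightarrow>
      4 * measure_bound E * norm (blinfun_apply (T t) x) * exp (- t * \<sigma> + t * e)"
    by (intro tendsto_intros semigroup_eq_exp_limit[OF A T gen \<delta> x t s])
  ultimately show "norm x \<le> 4 * measure_bound E * norm (blinfun_apply (T t) x) * exp (- t * \<sigma> + t * e)"
    by (intro tendsto_lowerbound) auto
qed

text \<open>
  The vectors in the ranges of \<open>E (\<delta> n)\<close>, for the bounded pieces \<open>\<delta> n\<close> of the spectrum, approximate
  every vector because \<open>E\<close> of the whole spectrum is the identity.
\<close>

lemma norm_semigroup_le: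
  assumes t: "0 \<le> t" and \<sigma>: "\<And>z. z \<in> spectrum D A \<Longrightarrow> Re z \<le> \<sigma>"
  shows "norm (T t) \<le> 4 * measure_bound E * exp (\<sigma> * t)"
proof (cases "t = 0")
  case True
  note E = scalar_type_spectral_measure
  have "norm (T 0) \<le> measure_bound E"
    using T norm_E_le[OF E, of UNIV] by (simp add: C0_semigroup_def E_UNIV[OF E])
  then show ?thesis using True measure_bound_nonneg[OF E] by simp
next
  case False
  then have "0 < t" using t by simp
  note E = scalar_type_spectral_measure
  define \<delta> where "\<delta> n = spectrum D A \<inter> cball 0 (real n)" for n
  have \<delta>: "\<delta> n \<in> sets borel" for n
    unfolding \<delta>_def using scalar_type_spectrum_borel by simp
  show ?thesis
  proof (rule norm_blinfun_bound)
    show "0 \<le> 4 * measure_bound E * exp (\<sigma> * t)" using measure_bound_nonneg[OF E] by simp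
    fix x
    have "(\<Union>n. \<delta> n) = spectrum D A"
      using real_arch_simple by (auto simp: \<delta>_def)
    moreover have "incseq \<delta>"
      by (auto simp: \<delta>_def incseq_def)
    ultimately have lim: "(\<lambda>n. blinfun_apply (E (\<delta> n)) x) \<longlonglongrightarrow> x"
      using E_increasing_LIMSEQ[where \<Delta> = \<delta> and x = x, OF E \<delta>] by (simp add: E_spectrum)
    have bound: "norm (blinfun_apply (T t) (blinfun_apply (E (\<delta> n)) x))
        \<le> 4 * measure_bound E * norm (blinfun_apply (E (\<delta> n)) x) * exp (t * \<sigma>)" for n
    proof (rule norm_semigroup_le_on_bounded_spectral_subspace[OF \<delta> _ _ _ \<open>0 < t\<close>])
      show "\<delta> n \<subseteq> spectrum D A" "\<delta> n \<subseteq> cball 0 (real n)" by (auto simp: \<delta>_def)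
      show "blinfun_apply (E (\<delta> n)) (blinfun_apply (E (\<delta> n)) x) = blinfun_apply (E (\<delta> n)) x"
        by (simp add: E_Int_apply[OF E \<delta> \<delta>])
      show "Re z \<le> \<sigma>" if "z \<in> \<delta> n" for z using that \<sigma> by (simp add: \<delta>_def)
    qed
    have "norm (blinfun_apply (T t) x) \<le> 4 * measure_bound E * norm x * exp (t * \<sigma>)"
    proof (rule LIMSEQ_le)
      show "(\<lambda>n. norm (blinfun_apply (T t) (blinfun_apply (E (\<delta> n)) x))) \<longlonglongrightarrow> norm (blinfun_apply (T t) x)"
        by (intro tendsto_norm blinfun.tendsto tendsto_const lim)
      show "(\<lambda>n. 4 * measure_bound E * norm (blinfun_apply (E (\<delta> n)) x) * exp (t * \<sigma>))
          \<longlonglongrightarrow> 4 * measure_bound E * norm x * exp (t * \<sigma>)"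
        by (intro tendsto_mult tendsto_norm tendsto_const lim)
      show "\<exists>N. \<forall>n\<ge>N. norm (blinfun_apply (T t) (blinfun_apply (E (\<delta> n)) x))
          \<le> 4 * measure_bound E * norm (blinfun_apply (E (\<delta> n)) x) * exp (t * \<sigma>)"
        using bound by blast
    qed
    then show "norm (blinfun_apply (T t) x) \<le> 4 * measure_bound E * exp (\<sigma> * t) * norm x"
      by (simp add: mult_ac)
  qed
qed

text \<open>
  A point of the spectrum to the right of \<open>\<omega>\<close> lies in the support of \<open>E\<close>, so a small disc about it,
  still to the right of \<open>\<omega> + \<epsilon>\<close>, carries a nonzero vector \<open>x\<close>. Comparing the lower bound on \<open>T t x\<close>
  with the assumed upper bound gives an inequality whose right-hand side tends to 0.
\<close>

lemma Re_spectrum_le_growth_exponent: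
  assumes M: "\<And>t. 0 \<le> t \<Longrightarrow> norm (T t) \<le> M * exp (\<omega> * t)" and z: "z \<in> spectrum D A"
  shows "Re z \<le> \<omega>"
proof (rule ccontr)
  note E = scalar_type_spectral_measure
  assume "\<not> Re z \<le> \<omega>"
  \<comment> \<open>Half of the gap: points within \<open>\<epsilon>\<close> of \<open>z\<close> have real part at least \<open>\<omega> + \<epsilon>\<close>.\<close>
  define \<epsilon> where "\<epsilon> = (Re z - \<omega>) / 2"
  have \<epsilon>: "0 < \<epsilon>" using \<open>\<not> Re z \<le> \<omega>\<close> by (simp add: \<epsilon>_def)
  have "E (ball z \<epsilon>) \<noteq> 0"
    using z \<epsilon> by (simp add: spectral_support_def flip: scalar_type_support)
  then obtain y where y: "blinfun_apply (E (ball z \<epsilon>)) y \<noteq> 0"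
    by (metis blinfun_eqI zero_blinfun.rep_eq)
  define \<delta> where "\<delta> = spectrum D A \<inter> ball z \<epsilon>"
  have \<delta>: "\<delta> \<in> sets borel" "\<delta> \<subseteq> spectrum D A" "\<delta> \<subseteq> cball 0 (cmod z + \<epsilon>)"
  proof -
    show "\<delta> \<in> sets borel" "\<delta> \<subseteq> spectrum D A"
      using scalar_type_spectrum_borel by (auto simp: \<delta>_def)
    show "\<delta> \<subseteq> cball 0 (cmod z + \<epsilon>)"
    proof
      fix w assume "w \<in> \<delta>"
      then have "cmod (z - w) < \<epsilon>" by (simp add: \<delta>_def dist_norm)
      then show "w \<in> cball 0 (cmod z + \<epsilon>)"
        using norm_triangle_sub[of w z] by (simp add: norm_minus_commute)
    qed
  qed
  define x where "x = blinfun_apply (E \<delta>) y"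
  have "x = blinfun_apply (E (ball z \<epsilon>)) y"
    using E_Int_apply[OF E scalar_type_spectrum_borel, of "ball z \<epsilon>" y]
    by (simp add: x_def \<delta>_def E_spectrum)
  then have "x \<noteq> 0" using y by simp
  have x: "blinfun_apply (E \<delta>) x = x"
    by (simp add: x_def E_Int_apply[OF E \<delta>(1) \<delta>(1)])
  have "1 \<le> 4 * measure_bound E * M * exp (- (\<epsilon> * t))" if t: "0 < t" for t
  proof -
    have "norm x \<le> 4 * measure_bound E * norm (blinfun_apply (T t) x) * exp (- t * (\<omega> + \<epsilon>))"
    proof (rule norm_le_semigroup_on_bounded_spectral_subspace[OF \<delta> x t])
      fix w assume "w \<in> \<delta>"
      then have "cmod (z - w) < \<epsilon>" by (simp add: \<delta>_def dist_norm)
      then have "Re (z - w) < \<epsilon>" using complex_Re_le_cmod[of "z - w"] by linarith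
      moreover have "2 * \<epsilon> = Re z - \<omega>" by (simp add: \<epsilon>_def)
      ultimately show "\<omega> + \<epsilon> \<le> Re w" by simp
    qed
    also have "\<dots> \<le> 4 * measure_bound E * (M * exp (\<omega> * t) * norm x) * exp (- t * (\<omega> + \<epsilon>))"
      using M[of t] t measure_bound_nonneg[OF E]
      by (intro mult_right_mono mult_left_mono order_trans[OF norm_blinfun]) auto
    also have "\<dots> = (4 * measure_bound E * M * exp (- (\<epsilon> * t))) * norm x"
    proof -
      have "exp (\<omega> * t) * exp (- t * (\<omega> + \<epsilon>)) = exp (- (\<epsilon> * t))"
        unfolding exp_add[symmetric] by (simp add: algebra_simps)
      then show ?thesis by (simp add: mult_ac)
    qed
    finally show ?thesis using \<open>x \<noteq> 0\<close> by simp
  qed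
  then have "\<forall>\<^sub>F t in at_top. 1 \<le> 4 * measure_bound E * M * exp (- (\<epsilon> * t))"
    by (auto intro: eventually_mono[OF eventually_gt_at_top])
  moreover have "((\<lambda>t. 4 * measure_bound E * M * exp (- (\<epsilon> * t))) \<longlongrightarrow> 0) at_top"
  proof (rule tendsto_mult_right_zero, rule filterlim_compose[OF exp_at_bot])
    show "LIM t at_top. - (\<epsilon> * t) :> at_bot"
      unfolding filterlim_uminus_at_bot minus_minus
      by (rule filterlim_tendsto_pos_mult_at_top[OF tendsto_const \<epsilon> filterlim_ident])
  qed
  ultimately have "1 \<le> (0::real)"
    by (intro tendsto_lowerbound[where F = "at_top :: real filter"]) auto
  then show False by simp
qed

text \<open>
  This excludes the value \<open>-\<infinity>\<close> of the spectral bound.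
\<close>

lemma spectrum_nonempty:
  assumes "(UNIV :: 'a set) \<noteq> {0}"
  shows "spectrum D A \<noteq> {}"
proof
  assume "spectrum D A = {}"
  then have "id_blinfun = (0 :: 'a \<Rightarrow>\<^sub>L 'a)"
    using E_spectrum E_empty[OF scalar_type_spectral_measure] by simp
  have "x = 0" for x :: 'a
  proof -
    have "x = blinfun_apply id_blinfun x" by simp
    also have "\<dots> = 0" unfolding \<open>id_blinfun = 0\<close> by simp
    finally show ?thesis .
  qed
  then show False using assms by auto
qed

lemma spectral_bound_le_growth_bound: "spectral_bound D A \<le> growth_bound T"
  unfolding spectral_bound_def growth_bound_def
proof (intro SUP_least INF_greatest)
  fix z \<omega>
  assume z: "z \<in> spectrum D A" and "\<omega> \<in> {\<omega>. \<exists>M\<ge>1. \<forall>t\<ge>0. norm (T t) \<le> M * exp (\<omega> * t)}"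
  then obtain M where "\<And>t. 0 \<le> t \<Longrightarrow> norm (T t) \<le> M * exp (\<omega> * t)" by blast
  from Re_spectrum_le_growth_exponent[OF this z] show "ereal (Re z) \<le> ereal \<omega>" by simp
qed

lemma growth_bound_le:
  assumes "(UNIV :: 'a set) \<noteq> {0}" and \<sigma>: "\<And>z. z \<in> spectrum D A \<Longrightarrow> Re z \<le> \<sigma>"
  shows "growth_bound T \<le> ereal \<sigma>"
proof -
  have "1 \<le> 4 * measure_bound E"
    using measure_bound_ge_1[OF scalar_type_spectral_measure assms(1)] by simp
  moreover have "\<forall>t\<ge>0. norm (T t) \<le> 4 * measure_bound E * exp (\<sigma> * t)"
    using norm_semigroup_le[OF _ \<sigma>] by blast
  ultimately show ?thesis
    unfolding growth_bound_def by (intro INF_lower) blast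
qed

end

theorem theorem4p1:
  fixes D :: "'a::complex_banach set"
    and A :: "'a \<Rightarrow> 'a"
    and E :: "complex set \<Rightarrow> 'a \<Rightarrow>\<^sub>L 'a"
    and T :: "real \<Rightarrow> 'a \<Rightarrow>\<^sub>L 'a"
  assumes "(UNIV :: 'a set) \<noteq> {0}"
    and "scalar_type_spectral_operator D A E"
    and "C0_semigroup T"
    and "generates D A T"
  shows "(uniformly_exponentially_stable T \<longleftrightarrow> spectral_bound D A < 0) \<and>
    (spectral_bound D A < 0 \<longrightarrow>
      (let M0 = (SUP \<delta>\<in>sets borel. norm (E \<delta>)) in
       \<exists>w0 :: real. growth_bound T = ereal w0 \<and> growth_bound T = spectral_bound D A \<and>
         1 \<le> M0 \<and> (\<forall>t\<ge>0. norm (T t) \<le> 4 * M0 * exp (w0 * t))))"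
proof -
  note ctx = assms(2-4)
  have lower: "spectral_bound D A \<le> growth_bound T"
    by (rule spectral_bound_le_growth_bound[OF ctx])
  have main: "\<exists>w0. growth_bound T = ereal w0 \<and> growth_bound T = spectral_bound D A \<and>
      1 \<le> measure_bound E \<and> (\<forall>t\<ge>0. norm (T t) \<le> 4 * measure_bound E * exp (w0 * t))"
    if neg: "spectral_bound D A < 0"
  proof -
    obtain z where "z \<in> spectrum D A" using spectrum_nonempty[OF ctx assms(1)] by blast
    then have "ereal (Re z) \<le> spectral_bound D A"
      unfolding spectral_bound_def by (rule SUP_upper)
    with neg obtain \<sigma> where \<sigma>: "spectral_bound D A = ereal \<sigma>"
      by (cases "spectral_bound D A") auto
    have Re: "Re z \<le> \<sigma>" if "z \<in> spectrum D A" for z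
    proof -
      have "ereal (Re z) \<le> spectral_bound D A"
        unfolding spectral_bound_def using that by (rule SUP_upper)
      then show ?thesis by (simp add: \<sigma>)
    qed
    have "growth_bound T = ereal \<sigma>"
      using growth_bound_le[OF ctx assms(1) Re] lower by (simp add: \<sigma>)
    then show ?thesis
      using \<sigma> measure_bound_ge_1[OF scalar_type_spectral_measure[OF ctx] assms(1)]
        norm_semigroup_le[OF ctx _ Re] by auto
  qed
  have "uniformly_exponentially_stable T \<longleftrightarrow> spectral_bound D A < 0"
    unfolding uniformly_exponentially_stable_def using lower main by (metis le_less_trans)
  then show ?thesis
    using main unfolding Let_def measure_bound_def by blast
qed

end
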